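(* Consider the Scarf-Hirota model whose initial endowment matrix $A$ satisfies condition (A), namely $A\mathbf{u}=\mathbf{u}$ and $\mathbf{u}^TA=\mathbf{u}^T$ with $\mathbf{u}=(1,1,1)^T$, with parameters $d_1,d_2,d_3,K,L$ and excess demand functions $E_1,E_2,E_3$ as defined in the context. Suppose $$H=4(d_1d_2+d_2d_3+d_3d_1)-(d_1+d_2+d_3)^2>0.$$ Then the system of ordinary differential equations $$\frac{dp_i}{dt}=p_i^{\gamma}E_i(\mathbf{p}),\qquad i=1,2,3,$$ is globally stable in the domain $\mathcal{D}=\{\mathbf{p} : p_1>0,\ p_2>0,\ p_3>0\}$, regardless of the value of $\gamma\ge 0$, and any solution of the equations (in $\mathcal{D}$) converges to the equilibrium price $\mathbf{p}^*=(1,1,1)^T$.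
   Context: Scarf-Hirota model (exchange economy with three consumers and three commodities): the consumers' utility functions are $u_1(\mathbf{x}_1)=\min\{x_{21},x_{31}\}$, $u_2(\mathbf{x}_2)=\min\{x_{12},x_{32}\}$, $u_3(\mathbf{x}_3)=\min\{x_{13},x_{23}\}$, where $\mathbf{x}_h=(x_{1h},x_{2h},x_{3h})^T$ is the consumption of consumer $h$. The vector $\mathbf{a}_h=(a_{1h},a_{2h},a_{3h})^T$ is the initial endowment vector of consumer $h$ ($h=1,2,3$), and $A=[\mathbf{a}_1,\mathbf{a}_2,\mathbf{a}_3]=(a_{ih})$ is the $3\times3$ matrix with columns $\mathbf{a}_h$. Condition (A) is $A\mathbf{u}=\mathbf{u}$, $\mathbf{u}^TA=\mathbf{u}^T$, where $\mathbf{u}=(1,1,1)^T$. A matrix satisfying condition (A) is written $$A=\begin{bmatrix} d_1 & d_3+L & d_2+K\\ d_3+K & d_2 & d_1+L\\ d_2+L & d_1+K & d_3\end{bmatrix},$$ with parameters $d_1\ge0$, $d_2\ge0$, $d_3\ge0$, $K$, $L$ satisfying $d_1+d_2+d_3+K+L=1$. Let $\mathbf{b}_1=(0,1,1)^T$, $\mathbf{b}_2=(1,0,1)^T$, $\mathbf{b}_3=(1,1,0)^T$ and $B=[\mathbf{b}_1,\mathbf{b}_2,\mathbf{b}_3]$. For a price vector $\mathbf{p}=(p_1,p_2,p_3)^T$ put $f_h=\dfrac{\mathbf{p}^T\mathbf{a}_h}{\mathbf{p}^T\mathbf{b}_h}$ and $\mathbf{f}=(f_1,f_2,f_3)^T$.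 The total excess demand is $\mathbf{E}(\mathbf{p})=(E_1,E_2,E_3)^T=B\mathbf{f}-A\mathbf{u}$; thus under condition (A), $E_1=f_2+f_3-1$, $E_2=f_3+f_1-1$, $E_3=f_1+f_2-1$. The equilibrium price vector is $\mathbf{p}^*=(1,1,1)^T$. The exponent $\gamma$ is an arbitrary nonnegative number.
   Formalization: Convergence to p*=(1,1,1) fails for e.g. the constant solution (2,2,2); instead every solution converges to c·p* for some c>0, and to p* itself when its initial price has the same conserved level (sum of p_i^(2-γ)/(2-γ), or of ln p_i if γ=2) as p*. *)

theory Defs
  imports "HOL-Analysis.Analysis"
begin

section \<open>Autonomous differential equations\<close>

text \<open>On \<open>I = {0..}\<close> or \<open>I = {0..<T}\<close> the derivative at the initial time is one-sided.\<close>

definition ode_solution_on ::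
  "('a::real_normed_vector \<Rightarrow> 'a) \<Rightarrow> 'a set \<Rightarrow> real set \<Rightarrow> (real \<Rightarrow> 'a) \<Rightarrow> bool" where
  "ode_solution_on F D I p \<longleftrightarrow>
     (\<forall>t\<in>I. p t \<in> D \<and> (p has_vector_derivative F (p t)) (at t within I))"

definition lyapunov_stable_on ::
  "('a::real_normed_vector \<Rightarrow> 'a) \<Rightarrow> 'a set \<Rightarrow> 'a \<Rightarrow> bool" where
  "lyapunov_stable_on F D e \<longleftrightarrow>
     (\<forall>\<epsilon>>0. \<exists>\<delta>>0. \<forall>p. ode_solution_on F D {0..} p \<and> dist (p 0) e < \<delta>
        \<longrightarrow> (\<forall>t\<ge>0. dist (p t) e < \<epsilon>))"

text \<open>
  A system is globally stable in \<open>D\<close> if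
  (i) from every initial point of \<open>D\<close> there is a solution that stays in \<open>D\<close> for all
  \<open>t \<ge> 0\<close>, and every other solution in \<open>D\<close> from that point, on however short a time
  interval, is a restriction of it;
  (ii) every equilibrium in \<open>D\<close> is Lyapunov stable;
  (iii) every solution converges to an equilibrium in \<open>D\<close>.
  The equilibrium is not required to be unique: prices are only determined up to scale, so
  the equilibria form rays.
\<close>

definition globally_stable_on ::
  "('a::real_normed_vector \<Rightarrow> 'a) \<Rightarrow> 'a set \<Rightarrow> bool" where
  "globally_stable_on F D \<longleftrightarrow>
     (\<forall>p0\<in>D. \<exists>p. ode_solution_on F D {0..} p \<and> p 0 = p0 \<and>
        (\<forall>T q. ode_solution_on F D {0..<T} q \<and> q 0 = p0 \<longrightarrow> (\<forall>t\<in>{0..<T}. q t = p t))) \<and>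
     (\<forall>e\<in>D. F e = 0 \<longrightarrow> lyapunov_stable_on F D e) \<and>
     (\<forall>p. ode_solution_on F D {0..} p \<longrightarrow> (\<exists>e\<in>D. F e = 0 \<and> (p \<longlongrightarrow> e) at_top))"

section \<open>The Scarf-Hirota model\<close>

text \<open>
  \<open>A $ i $ h\<close> is consumer \<open>h\<close>'s endowment of commodity \<open>i\<close>, so the endowment vector of
  consumer \<open>h\<close> is \<open>column h A\<close>.
\<close>

definition u :: "real^3" where
  "u = vector [1, 1, 1]"

definition condition_A :: "real^3^3 \<Rightarrow> bool" where
  "condition_A A \<longleftrightarrow> A *v u = u \<and> u v* A = u"

definition endowment_matrix :: "real \<Rightarrow> real \<Rightarrow> real \<Rightarrow> real \<Rightarrow> real \<Rightarrow> real^3^3" where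
  "endowment_matrix d1 d2 d3 K L = vector
     [vector [d1,     d3 + L, d2 + K],
      vector [d3 + K, d2,     d1 + L],
      vector [d2 + L, d1 + K, d3]]"

text \<open>
  With utility \<open>min {x\<^sub>j, x\<^sub>k}\<close> on the two commodities other than \<open>h\<close>, consumer \<open>h\<close> demands
  \<open>f\<^sub>h\<close> units of the bundle \<open>column h B\<close>.
\<close>

definition B :: "real^3^3" where
  "B = vector [vector [0, 1, 1], vector [1, 0, 1], vector [1, 1, 0]]"

definition demand_level :: "real^3^3 \<Rightarrow> real^3 \<Rightarrow> real^3" where
  "demand_level A p = (\<chi> h. (p \<bullet> column h A) / (p \<bullet> column h B))"

definition excess_demand :: "real^3^3 \<Rightarrow> real^3 \<Rightarrow> real^3" where
  "excess_demand A p = B *v demand_level A p - A *v u"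

definition positive_prices :: "(real^3) set" where
  "positive_prices = {p. \<forall>i. p $ i > 0}"

definition price_field :: "real \<Rightarrow> real^3^3 \<Rightarrow> real^3 \<Rightarrow> real^3" where
  "price_field \<gamma> A p = (\<chi> i. (p $ i) powr \<gamma> * excess_demand A p $ i)"

definition p_star :: "real^3" where
  "p_star = vector [1, 1, 1]"

text \<open>
  By Walras' law \<open>\<Sum>i. p\<^sub>i * E\<^sub>i(p) = 0\<close>, the sum of antiderivatives of \<open>p\<^sub>i powr (1 - \<gamma>)\<close> is
  constant along solutions of \<open>p\<^sub>i' = p\<^sub>i powr \<gamma> * E\<^sub>i(p)\<close>. It fixes the price level: a
  trajectory can converge to \<open>p_star\<close> itself, rather than to a multiple of it, only on the
  level surface of \<open>p_star\<close>.
\<close>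

definition price_level :: "real \<Rightarrow> real^3 \<Rightarrow> real" where
  "price_level \<gamma> p =
     (\<Sum>i\<in>UNIV. if \<gamma> = 2 then ln (p $ i) else (p $ i) powr (2 - \<gamma>) / (2 - \<gamma>))"

section \<open>Consistency of the definitions\<close>

lemma condition_A_iff_endowment_matrix:
  "condition_A A \<longleftrightarrow>
     (\<exists>d1 d2 d3 K L. d1 + d2 + d3 + K + L = 1 \<and> A = endowment_matrix d1 d2 d3 K L)"
proof
  assume "condition_A A"
  then have s: "A$1$1 + A$1$2 + A$1$3 = 1" "A$2$1 + A$2$2 + A$2$3 = 1"
    "A$3$1 + A$3$2 + A$3$3 = 1" "A$1$1 + A$2$1 + A$3$1 = 1"
    "A$1$2 + A$2$2 + A$3$2 = 1" "A$1$3 + A$2$3 + A$3$3 = 1"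
    by (simp_all add: condition_A_def u_def vec_eq_iff forall_3 sum_3
        matrix_vector_mult_def vector_matrix_mult_def)
  let ?K = "A$2$1 - A$3$3" and ?L = "A$1$2 - A$3$3"
  have "A$1$1 + A$2$2 + A$3$3 + ?K + ?L = 1"
    using s by linarith
  moreover have "A = endowment_matrix (A$1$1) (A$2$2) (A$3$3) ?K ?L"
    unfolding endowment_matrix_def vec_eq_iff forall_3 vector_3 using s by linarith
  ultimately show "\<exists>d1 d2 d3 K L. d1 + d2 + d3 + K + L = 1 \<and>
      A = endowment_matrix d1 d2 d3 K L"
    by blast
next
  assume "\<exists>d1 d2 d3 K L. d1 + d2 + d3 + K + L = 1 \<and> A = endowment_matrix d1 d2 d3 K L"
  then show "condition_A A"
    by (auto simp: condition_A_def u_def endowment_matrix_def vec_eq_iff forall_3 sum_3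
        matrix_vector_mult_def vector_matrix_mult_def)
qed

lemma excess_demand_condition_A:
  assumes "condition_A A"
  shows "excess_demand A p $ 1 = demand_level A p $ 2 + demand_level A p $ 3 - 1"
    and "excess_demand A p $ 2 = demand_level A p $ 3 + demand_level A p $ 1 - 1"
    and "excess_demand A p $ 3 = demand_level A p $ 1 + demand_level A p $ 2 - 1"
  using assms
  by (simp_all add: condition_A_def excess_demand_def u_def B_def matrix_vector_mult_def sum_3)

end

theory Submission
  imports Defs
begin

text \<open>
  Two weighted sums of the equations govern the dynamics. Multiplying the \<open>i\<close>-th equation by
  \<open>p\<^sub>i powr (1 - \<gamma>)\<close> and summing gives \<open>\<Sum> p\<^sub>i E\<^sub>i\<close>, which is 0 by Walras' law: the price level is
  conserved. Multiplying by \<open>p\<^sub>i powr (- 1 - \<gamma>)\<close> instead gives \<open>\<Sum> E\<^sub>i / p\<^sub>i\<close>, and under condition (A)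
  \<open>p\<^sub>1 p\<^sub>2 p\<^sub>3 \<Sum> E\<^sub>i / p\<^sub>i = d\<^sub>1 X\<^sup>2 - (d\<^sub>1 + d\<^sub>2 - d\<^sub>3) X Y + d\<^sub>2 Y\<^sup>2\<close>
  with \<open>X = p\<^sub>1 - p\<^sub>3\<close> and \<open>Y = p\<^sub>2 - p\<^sub>3\<close> (\<open>reciprocal_excess_sum\<close>). The discriminant of this form is \<open>- H\<close>,
  so \<open>H > 0\<close> says precisely that the form is definite. Hence \<open>- \<Sum> power_primitive (- \<gamma>) (p\<^sub>i)\<close> decreases
  strictly outside the ray of equilibria \<open>(s, s, s)\<close>, for every \<open>\<gamma>\<close>. Adding \<open>1 / s\<^sup>2\<close> times the price
  level, which is constant, turns it into a function with a strict minimum at \<open>(s, s, s)\<close>; so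
  every equilibrium is stable (\<open>equilibrium_stability\<close>).

  For \<open>\<gamma> > 2\<close> this function stays bounded when a price tends to infinity, so it cannot
  exclude escape to infinity. Compactness comes from the signs of the excess demands far from the
  diagonal instead. A commodity that is very cheap relative to another one is in excess demand,
  again because \<open>H > 0\<close>, and a commodity that is very expensive relative to both others is in excess
  supply, because \<open>H > 0\<close> forces every \<open>d\<^sub>i\<close> to be positive. On a fixed level surface of the price
  level, a face of a suitable box \<open>[m, M]\<^sup>3\<close> is met only where one of these two situations occurs,
  so no trajectory can leave the box (\<open>trapping_box\<close>, \<open>trapping_region\<close>).

  On the box the field is Lipschitz. Global existence follows by freezing the field outside
  the box, and uniqueness from Gronwall's inequality. A trapped trajectory
  accumulates at an equilibrium, since otherwise the decreasing function would be unbounded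
  below, and stability makes the accumulation point a limit. Finally, the price level is
  strictly monotone along the ray of equilibria, so it determines which of them is the limit.
\<close>

section \<open>Global existence and uniqueness for Lipschitz fields\<close>

lemma has_vector_derivative_integral_halfline:
  fixes f :: "real \<Rightarrow> 'a::banach"
  assumes "continuous_on {0..} f" and "0 \<le> t"
  shows "((\<lambda>s. integral {0..s} f) has_vector_derivative f t) (at t within {0..})"
proof -
  have "continuous_on {0..t + 1} f"
    using assms(1) by (rule continuous_on_subset) auto
  then have "((\<lambda>s. integral {0..s} f) has_vector_derivative f t) (at t within {0..t + 1})"
    using \<open>0 \<le> t\<close> by (intro integral_has_vector_derivative) auto
  moreover have "at t within {0..t + 1} = at t within {0..}"
    by (rule at_within_nhd[of t "{..<t + 1}"]) auto
  ultimately show ?thesis by simp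
qed

text \<open>
  Writing the solution as \<open>x0 + exp (\<mu> t) \<phi>(t)\<close> and solving for \<open>\<phi>\<close> among the bounded continuous
  functions amounts to measuring curves in an exponentially weighted supremum norm. In this
  norm the Picard operator contracts on the whole half-line at once, so that no local solutions
  have to be glued together.
\<close>

lemma global_solution_of_bounded_lipschitz_field:
  fixes G :: "'a::banach \<Rightarrow> 'a"
  assumes lip: "L-lipschitz_on UNIV G" and bdd: "bounded (range G)"
  obtains p where "p 0 = x0" and "ode_solution_on G UNIV {0..} p"
proof -
  \<comment> \<open>the contraction factor is \<open>L / \<mu>\<close>; adding 1 keeps \<open>\<mu>\<close> positive when \<open>L = 0\<close>\<close>
  define \<mu> where "\<mu> = 2 * L + 1"
  have "L \<ge> 0" using lip by (rule lipschitz_on_nonneg)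
  then have \<mu>: "\<mu> > 0" "2 * L \<le> \<mu>" by (auto simp: \<mu>_def)
  obtain C where C: "norm (G x) \<le> C" for x
    using bdd by (auto simp: bounded_iff)
  have contG: "continuous_on S G" for S
    using lipschitz_on_continuous_on[OF lip] continuous_on_subset by blast
  define g where "g \<phi> s = G (x0 + exp (\<mu> * s) *\<^sub>R apply_bcontfun \<phi> s)" for \<phi> s
  define J where "J \<phi> t = exp (- \<mu> * t) *\<^sub>R integral {0..t} (g \<phi>)" for \<phi> t
  have contg: "continuous_on S (g \<phi>)" for S \<phi>
    unfolding g_def
    by (rule continuous_on_compose2[OF contG[of UNIV]]) (auto intro!: continuous_intros)
  have intg: "g \<phi> integrable_on {0..t}" for \<phi> t
    by (intro integrable_continuous_real contg)
  have contJ: "continuous_on {0..} (J \<phi>)" for \<phi>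
    unfolding J_def
    using has_vector_derivative_integral_halfline[OF contg]
    by (intro continuous_intros continuous_on_vector_derivative) auto
  have intexp: "((\<lambda>s. exp (\<mu> * s)) has_integral (exp (\<mu> * t) - 1) / \<mu>) {0..t}" if "0 \<le> t" for t
  proof -
    have "((\<lambda>s. exp (\<mu> * s)) has_integral exp (\<mu> * t) / \<mu> - exp (\<mu> * 0) / \<mu>) {0..t}"
      using that \<mu> by (intro fundamental_theorem_of_calculus)
        (auto intro!: derivative_eq_intros simp: has_real_derivative_iff_has_vector_derivative[symmetric])
    then show ?thesis by (simp add: diff_divide_distrib)
  qed
  have boundJ: "norm (J \<phi> t) \<le> C / \<mu>" if "0 \<le> t" for \<phi> t
  proof -
    have "norm (integral {0..t} (g \<phi>)) \<le> C * (t - 0)"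
      using that C by (intro integral_bound contg) (auto simp: g_def)
    then have "norm (J \<phi> t) \<le> exp (- \<mu> * t) * (C * t)"
      by (auto simp: J_def intro: mult_left_mono)
    also have "\<dots> = (C / \<mu>) * ((\<mu> * t) * exp (- (\<mu> * t)))"
      using \<mu> by simp
    also have "\<dots> \<le> (C / \<mu>) * 1"
    proof (rule mult_left_mono)
      have "\<mu> * t \<le> exp (\<mu> * t)"
        using exp_ge_add_one_self[of "\<mu> * t"] by linarith
      then show "\<mu> * t * exp (- (\<mu> * t)) \<le> 1"
        by (simp add: exp_minus field_simps)
      show "0 \<le> C / \<mu>"
        using \<mu> order_trans[OF norm_ge_zero C] by simp
    qed
    finally show ?thesis by simp
  qed
  \<comment> \<open>bounded continuous functions live on a whole type, so negative times are collapsed to 0\<close>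
  have "(\<lambda>t. J \<phi> (max 0 t)) \<in> bcontfun" for \<phi>
  proof (rule bcontfun_normI)
    show "continuous_on UNIV (\<lambda>t. J \<phi> (max 0 t))"
      by (rule continuous_on_compose2[OF contJ]) (auto intro!: continuous_intros)
    show "norm (J \<phi> (max 0 t)) \<le> C / \<mu>" for t
      by (rule boundJ) simp
  qed
  then have "\<exists>T. \<forall>\<phi> t. apply_bcontfun (T \<phi>) t = J \<phi> (max 0 t)"
    by (intro exI[of _ "\<lambda>\<phi>. Bcontfun (\<lambda>t. J \<phi> (max 0 t))"]) (simp add: Bcontfun_inverse)
  then obtain T where T: "\<And>\<phi> t. apply_bcontfun (T \<phi>) t = J \<phi> (max 0 t)" by blast
  have diffJ: "dist (J \<phi> t) (J \<psi> t) \<le> 1/2 * dist \<phi> \<psi>" if "0 \<le> t" for \<phi> \<psi> t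
  proof -
    let ?D = "dist \<phi> \<psi>"
    have g: "norm (g \<phi> s - g \<psi> s) \<le> (L * ?D) * exp (\<mu> * s)" for s
    proof -
      have "norm (g \<phi> s - g \<psi> s) \<le> L * norm (exp (\<mu> * s) *\<^sub>R (\<phi> s - \<psi> s))"
        unfolding g_def using lipschitz_on_normD[OF lip, of "x0 + exp (\<mu> * s) *\<^sub>R \<phi> s" "x0 + exp (\<mu> * s) *\<^sub>R \<psi> s"]
        by (simp add: algebra_simps)
      also have "\<dots> = L * exp (\<mu> * s) * dist (\<phi> s) (\<psi> s)"
        by (simp add: dist_norm)
      also have "\<dots> \<le> L * exp (\<mu> * s) * ?D"
        using \<open>L \<ge> 0\<close> by (intro mult_left_mono dist_bounded) auto
      finally show ?thesis by (simp add: mult_ac)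
    qed
    have "dist (J \<phi> t) (J \<psi> t) = exp (- \<mu> * t) * norm (integral {0..t} (\<lambda>s. g \<phi> s - g \<psi> s))"
      unfolding J_def dist_norm
      by (subst integral_diff[OF intg intg]) (simp flip: scaleR_diff_right)
    also have "\<dots> \<le> exp (- \<mu> * t) * integral {0..t} (\<lambda>s. (L * ?D) * exp (\<mu> * s))"
      using g by (intro mult_left_mono integral_norm_bound_integral integrable_diff intg
          integrable_continuous_real continuous_intros) auto
    also have "integral {0..t} (\<lambda>s. (L * ?D) * exp (\<mu> * s)) = (L * ?D) * ((exp (\<mu> * t) - 1) / \<mu>)"
      using has_integral_mult_right[OF intexp[OF that]] by (rule integral_unique)
    also have "exp (- \<mu> * t) * \<dots> = (L / \<mu>) * ?D * (1 - exp (- \<mu> * t))"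
      using \<mu> by (simp add: field_simps exp_minus)
    also have "\<dots> \<le> (L / \<mu>) * ?D * 1"
      using \<mu> \<open>L \<ge> 0\<close> by (intro mult_left_mono) auto
    also have "\<dots> \<le> 1/2 * ?D"
      using \<mu> by (intro order_trans[OF eq_refl[OF mult_1_right]] mult_right_mono) (auto simp: field_simps)
    finally show ?thesis .
  qed
  have "\<exists>!\<phi>. T \<phi> = \<phi>"
  proof (rule banach_fix_type[where c = "1/2"])
    show "\<forall>\<phi> \<psi>. dist (T \<phi>) (T \<psi>) \<le> 1/2 * dist \<phi> \<psi>"
      by (intro allI dist_bound) (auto simp: T intro!: diffJ[simplified])
  qed auto
  then obtain \<phi> where "T \<phi> = \<phi>" by blast
  then have \<phi>: "apply_bcontfun \<phi> t = J \<phi> t" if "0 \<le> t" for t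
    using T[of \<phi> t] that by simp
  define p where "p t = x0 + integral {0..t} (g \<phi>)" for t
  have g_p: "g \<phi> t = G (p t)" if "0 \<le> t" for t
    using that by (simp add: g_def \<phi> J_def p_def flip: exp_add)
  show ?thesis
  proof
    show "p 0 = x0" by (simp add: p_def)
    show "ode_solution_on G UNIV {0..} p"
      unfolding ode_solution_on_def
    proof (intro ballI conjI UNIV_I)
      fix t :: real assume "t \<in> {0..}"
      then have "((\<lambda>s. integral {0..s} (g \<phi>)) has_vector_derivative g \<phi> t) (at t within {0..})"
        by (intro has_vector_derivative_integral_halfline contg) auto
      then have "(p has_vector_derivative 0 + g \<phi> t) (at t within {0..})"
        unfolding p_def by (intro has_vector_derivative_add has_vector_derivative_const)
      then show "(p has_vector_derivative G (p t)) (at t within {0..})"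
        using \<open>t \<in> {0..}\<close> by (simp add: g_p)
    qed
  qed
qed

lemma nonincreasing_on_interval:
  fixes f :: "real \<Rightarrow> real"
  assumes "a \<le> b" and "{a..b} \<subseteq> I"
    and "\<And>t. t \<in> {a..b} \<Longrightarrow> (f has_real_derivative f' t) (at t within I)"
    and "\<And>t. t \<in> {a..b} \<Longrightarrow> f' t \<le> 0"
  shows "f b \<le> f a"
proof -
  have "\<exists>x\<in>{a..b}. f b - f a = f' x * (b - a)"
    using assms(1,3) has_field_derivative_subset[OF _ assms(2)]
    by (intro mvt_very_simple) (auto simp: has_field_derivative_def)
  then show ?thesis using assms(1,4) by (smt (verit) mult_nonpos_nonneg)
qed

text \<open>
  Gronwall's argument in differential form: \<open>exp (- 2 L t)\<close> times the squared distance of the two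
  solutions cannot increase.
\<close>

lemma solutions_agree_if_lipschitz:
  fixes F :: "'a::real_inner \<Rightarrow> 'a"
  assumes lip: "L-lipschitz_on S F" and "p 0 = q 0"
    and p: "ode_solution_on F S {0..<T} p" and q: "ode_solution_on F S {0..<T} q"
    and t: "t \<in> {0..<T}"
  shows "q t = p t"
proof -
  define w where "w s = exp (- (2 * L * s)) * ((q s - p s) \<bullet> (q s - p s))" for s
  define w' where "w' s = exp (- (2 * L * s)) *
    (2 * ((F (q s) - F (p s)) \<bullet> (q s - p s)) - 2 * L * ((q s - p s) \<bullet> (q s - p s)))" for s
  have "w t \<le> w 0"
  proof (rule nonincreasing_on_interval[where f = w and I = "{0..<T}" and f' = w'])
    fix s assume s: "s \<in> {0..t}"
    then have "(p has_vector_derivative F (p s)) (at s within {0..<T})"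
      "(q has_vector_derivative F (q s)) (at s within {0..<T})"
      and in_S: "p s \<in> S" "q s \<in> S"
      using p q t by (auto simp: ode_solution_on_def)
    then show "(w has_real_derivative w' s) (at s within {0..<T})"
      unfolding w_def w'_def has_field_derivative_def has_vector_derivative_def
      by (auto intro!: derivative_eq_intros simp: fun_eq_iff inner_commute algebra_simps)
    have "(F (q s) - F (p s)) \<bullet> (q s - p s) \<le> norm (F (q s) - F (p s)) * norm (q s - p s)"
      by (rule norm_cauchy_schwarz)
    also have "\<dots> \<le> (L * norm (q s - p s)) * norm (q s - p s)"
      using lipschitz_on_normD[OF lip in_S(2,1)] by (intro mult_right_mono) auto
    also have "\<dots> = L * ((q s - p s) \<bullet> (q s - p s))"
      by (simp add: power2_eq_square flip: power2_norm_eq_inner)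
    finally show "w' s \<le> 0"
      by (simp add: w'_def mult_le_0_iff)
  qed (use t in auto)
  then have "(q t - p t) \<bullet> (q t - p t) \<le> 0"
    using \<open>p 0 = q 0\<close> by (simp add: w_def mult_le_0_iff)
  then have "(q t - p t) \<bullet> (q t - p t) = 0"
    using inner_ge_zero[of "q t - p t"] by linarith
  then show ?thesis by simp
qed

lemma ode_solution_on_subset:
  "ode_solution_on F D I p \<Longrightarrow> J \<subseteq> I \<Longrightarrow> ode_solution_on F D J p"
  by (auto simp: ode_solution_on_def intro: has_vector_derivative_within_subset)

text \<open>
  The velocity of the curve outside \<open>K\<close> is left arbitrary, so that the notion applies both to
  solutions of the given equation and to solutions of an equation modified outside \<open>K\<close>.
\<close>

definition traps :: "('a::real_normed_vector \<Rightarrow> 'a) \<Rightarrow> 'a set \<Rightarrow> 'a \<Rightarrow> bool" where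
  "traps F K p0 \<longleftrightarrow> (\<forall>p v T. 0 \<le> T \<and> p 0 = p0 \<and>
     (\<forall>t\<in>{0..T}. (p has_vector_derivative v t) (at t within {0..T}) \<and>
        (p t \<in> K \<longrightarrow> v t = F (p t))) \<longrightarrow> p T \<in> K)"

lemma trapsD:
  assumes "traps F K p0" and "p 0 = p0" and G: "ode_solution_on G S I p" and "\<And>x. x \<in> K \<Longrightarrow> G x = F x"
    and "0 \<le> t" and "{0..t} \<subseteq> I"
  shows "p t \<in> K"
  using assms(1)[unfolded traps_def, rule_format, of t p "\<lambda>t. G (p t)"] assms(2,4,5)
    ode_solution_on_subset[OF G \<open>{0..t} \<subseteq> I\<close>]
  by (auto simp: ode_solution_on_def)

section \<open>Signs and weighted sums of excess demands\<close>

text \<open>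
  The model is invariant under the cyclic shift of commodities, consumers and the parameters
  \<open>d\<^sub>1, d\<^sub>2, d\<^sub>3\<close>, so one function describes all three excess demands: \<open>x\<close> is the price of the
  commodity in question, \<open>y\<close> and \<open>z\<close> are the prices of the next two in cyclic order, and \<open>a\<close>, \<open>b\<close>,
  \<open>c\<close> are the corresponding diagonal entries of the endowment matrix.
\<close>

definition excess :: "real \<Rightarrow> real \<Rightarrow> real \<Rightarrow> real \<Rightarrow> real \<Rightarrow> real \<Rightarrow> real \<Rightarrow> real \<Rightarrow> real" where
  "excess a b c K L x y z =
     (b * y + (a + K) * z + (c + L) * x) / (z + x) +
     ((a + L) * y + c * z + (b + K) * x) / (y + x) - 1"

lemma positive_binary_quadratic:
  fixes a b c :: real
  assumes "a > 0" and "b\<^sup>2 < 4 * a * c" and "x \<noteq> 0 \<or> y \<noteq> 0"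
  shows "a * x\<^sup>2 - b * x * y + c * y\<^sup>2 > 0"
proof -
  have "4 * a * (a * x\<^sup>2 - b * x * y + c * y\<^sup>2) = (2 * a * x - b * y)\<^sup>2 + (4 * a * c - b\<^sup>2) * y\<^sup>2"
    by (simp add: power2_eq_square algebra_simps)
  also have "\<dots> > 0"
  proof (cases "y = 0")
    case True
    then show ?thesis using assms by simp
  next
    case False
    then show ?thesis using assms by (intro add_nonneg_pos mult_pos_pos) auto
  qed
  finally show ?thesis using \<open>a > 0\<close> by (simp add: zero_less_mult_iff)
qed

text \<open>
  The discriminant condition is open, which leaves room for the error terms in the next lemma.
\<close>

lemma discriminant_stable:
  fixes a b c :: real
  assumes "b > 0" and "c > 0" and "(b + c - a)\<^sup>2 < 4 * b * c"
  obtains e where "e > 0" and "e < b" and "e < c"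
    and "(b + c - a + 2 * e)\<^sup>2 < 4 * (b - e) * (c - e)"
proof -
  have "((\<lambda>e. 4 * (b - e) * (c - e) - (b + c - a + 2 * e)\<^sup>2) \<longlongrightarrow>
          4 * (b - 0) * (c - 0) - (b + c - a + 2 * 0)\<^sup>2) (at_right 0)"
    by (intro tendsto_intros)
  then have "\<forall>\<^sub>F e in at_right 0. 0 < 4 * (b - e) * (c - e) - (b + c - a + 2 * e)\<^sup>2"
    by (rule order_tendstoD) (use assms in auto)
  moreover have "\<forall>\<^sub>F e in at_right 0. 0 < e \<and> e < b \<and> e < c"
    using assms by (intro eventually_conj eventually_at_right_less eventually_at_rightI[of 0 b] eventually_at_rightI[of 0 c]) auto
  ultimately have "\<forall>\<^sub>F e in at_right 0. 0 < e \<and> e < b \<and> e < c \<and>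
      (b + c - a + 2 * e)\<^sup>2 < 4 * (b - e) * (c - e)"
    by eventually_elim auto
  then show ?thesis
    using that eventually_happens[of _ "at_right (0::real)"] by (auto simp: trivial_limit_at_right_real)
qed

text \<open>
  When \<open>x\<close> is negligible against the larger of \<open>y\<close> and \<open>z\<close>, the excess demand is nearly
  \<open>b r + c / r - (b + c - a)\<close> with \<open>r = (y + x) / (z + x)\<close>. This is positive for every \<open>r > 0\<close>,
  because the quadratic \<open>b r\<^sup>2 - (b + c - a) r + c\<close> has negative discriminant. The error is at
  most \<open>e (1 + r) + e (1 + 1 / r)\<close>, which only perturbs the coefficients of that quadratic, so
  the estimate is uniform in \<open>r\<close> even though \<open>r\<close> ranges over all of \<open>(0, \<infinity>)\<close>.
\<close>

lemma excess_pos_if_cheap: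
  assumes "b > 0" and "c > 0" and "(b + c - a)\<^sup>2 < 4 * b * c" and "a + b + c + K + L = 1"
  obtains R where "R \<ge> 1"
    and "\<And>x y z. \<lbrakk>0 < x; 0 < y; 0 < z; R * x \<le> max y z\<rbrakk> \<Longrightarrow> 0 < excess a b c K L x y z"
proof -
  obtain e where e: "e > 0" "e < b" "e < c"
    "(b + c - a + 2 * e)\<^sup>2 < 4 * (b - e) * (c - e)"
    using discriminant_stable[OF assms(1-3)] by blast
  define k1 where "k1 = c + L - b - a - K"
  define k2 where "k2 = b + K - c - a - L"
  define C where "C = \<bar>k1\<bar> + \<bar>k2\<bar> + 1"
  have "0 < excess a b c K L x y z" 
    if pos: "0 < x" "0 < y" "0 < z" and R: "max 1 (C / e) * x \<le> max y z" for x y z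
  proof -
    define Y where "Y = y + x"
    define Z where "Z = z + x"
    define r where "r = Y / Z"
    have YZ: "Y > 0" "Z > 0" "r > 0" using pos by (auto simp: Y_def Z_def r_def)
    have "C / e * x \<le> max 1 (C / e) * x" using pos by (intro mult_right_mono) auto
    also have "\<dots> \<le> Y + Z" using R pos by (simp add: Y_def Z_def)
    finally have x: "C * x \<le> e * (Y + Z)" using e by (simp add: field_simps)
    have k: "- C \<le> k1" "- C \<le> k2" by (auto simp: C_def)
    have "k1 * (x / Z) \<ge> - C * (x / Z)" "k2 * (x / Y) \<ge> - C * (x / Y)"
      using YZ pos by (intro mult_right_mono[OF k(1)] mult_right_mono[OF k(2)]; simp)+
    moreover have "C * (x / Z) \<le> e * (r + 1)" "C * (x / Y) \<le> e * (1 + 1 / r)"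
      using x YZ by (auto simp: r_def field_simps)
    ultimately have err: "k1 * (x / Z) + k2 * (x / Y) \<ge> - e * (r + 1) - e * (1 + 1 / r)"
      by linarith
    have "excess a b c K L x y z = (b * r + (a + K) + k1 * (x / Z)) + (c / r + (a + L) + k2 * (x / Y)) - 1"
    proof -
      have "(b * y + (a + K) * z + (c + L) * x) / (z + x) = b * r + (a + K) + k1 * (x / Z)"
        using YZ unfolding Z_def[symmetric] r_def
        by (simp add: field_simps) (simp add: Y_def Z_def k1_def algebra_simps)
      moreover have "((a + L) * y + c * z + (b + K) * x) / (y + x) = c / r + (a + L) + k2 * (x / Y)"
        using YZ unfolding Y_def[symmetric] r_def
        by (simp add: field_simps) (simp add: Y_def Z_def k2_def algebra_simps)
      ultimately show ?thesis unfolding excess_def by simp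
    qed
    also have "\<dots> = b * r + c / r - (b + c - a) + (k1 * (x / Z) + k2 * (x / Y))"
      using assms(4) by (simp add: algebra_simps)
    finally have "excess a b c K L x y z \<ge> (b - e) * r + (c - e) / r - (b + c - a + 2 * e)"
      using err by (simp add: algebra_simps diff_divide_distrib)
    moreover have "(b - e) * r + (c - e) / r - (b + c - a + 2 * e) =
        ((b - e) * r\<^sup>2 - (b + c - a + 2 * e) * r * 1 + (c - e) * 1\<^sup>2) / r"
      using YZ by (simp add: field_simps power2_eq_square)
    moreover have "\<dots> > 0"
      using e YZ by (intro divide_pos_pos positive_binary_quadratic) auto
    ultimately show ?thesis by linarith
  qed
  then show ?thesis using that[of "max 1 (C / e)"] by auto
qed

text \<open>
  As \<open>y / x\<close> and \<open>z / x\<close> tend to 0, the excess demand tends to \<open>- a\<close>.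
\<close>

lemma excess_neg_if_expensive:
  assumes "a > 0" "b > 0" "c > 0" and "a + b + c + K + L = 1"
  obtains R where "R \<ge> 1"
    and "\<And>x y z. \<lbrakk>0 < x; 0 < y; 0 < z; R * y \<le> x; R * z \<le> x\<rbrakk> \<Longrightarrow> excess a b c K L x y z < 0"
proof -
  define k1 where "k1 = a + K - c - L"
  define k2 where "k2 = a + L - b - K"
  define N where "N = b + c + \<bar>k1\<bar> + \<bar>k2\<bar>"
  define R where "R = N / a + 1"
  have N: "N > 0" "N / R < a" "R \<ge> 1"
    using assms by (auto simp: R_def N_def field_simps add_pos_nonneg intro!: add_pos_nonneg)
  have "excess a b c K L x y z < 0"
    if pos: "0 < x" "0 < y" "0 < z" and R: "R * y \<le> x" "R * z \<le> x" for x y z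
  proof -
    have yz: "y / x \<le> 1 / R" "z / x \<le> 1 / R"
      using R pos N by (simp_all add: field_simps)
    have "y / (z + x) \<le> y / x" "z / (z + x) \<le> z / x" "z / (y + x) \<le> z / x" "y / (y + x) \<le> y / x"
      using pos by (auto intro!: divide_left_mono)
    then have le: "y / (z + x) \<le> 1 / R" "z / (z + x) \<le> 1 / R"
      "z / (y + x) \<le> 1 / R" "y / (y + x) \<le> 1 / R"
      using yz by linarith+
    have k: "k1 \<le> \<bar>k1\<bar>" "k2 \<le> \<bar>k2\<bar>" by auto
    have "excess a b c K L x y z = b * (y / (z + x)) + (c + L) + k1 * (z / (z + x))
        + (c * (z / (y + x)) + (b + K) + k2 * (y / (y + x))) - 1"
    proof -
      have "(b * y + (a + K) * z + (c + L) * x) / (z + x) = b * (y / (z + x)) + (c + L) + k1 * (z / (z + x))"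
      proof -
        have num: "b * y + (a + K) * z + (c + L) * x = b * y + (c + L) * (z + x) + k1 * z"
          by (simp add: k1_def algebra_simps)
        show ?thesis unfolding num using pos by (simp add: add_divide_distrib)
      qed
      moreover have "((a + L) * y + c * z + (b + K) * x) / (y + x) = c * (z / (y + x)) + (b + K) + k2 * (y / (y + x))"
      proof -
        have num: "(a + L) * y + c * z + (b + K) * x = c * z + (b + K) * (y + x) + k2 * y"
          by (simp add: k2_def algebra_simps)
        show ?thesis unfolding num using pos by (simp add: add_divide_distrib)
      qed
      ultimately show ?thesis unfolding excess_def by simp
    qed
    also have "\<dots> = - a + (b * (y / (z + x)) + k1 * (z / (z + x)) + c * (z / (y + x)) + k2 * (y / (y + x)))"
      using assms(4) by (simp add: algebra_simps)
    also have "\<dots> \<le> - a + (b * (1 / R) + \<bar>k1\<bar> * (1 / R) + c * (1 / R) + \<bar>k2\<bar> * (1 / R))"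
      using le assms k pos by (intro add_mono mult_mono order_refl) auto
    also have "\<dots> = - a + N / R" by (simp add: N_def add_divide_distrib)
    also have "\<dots> < 0" using N by simp
    finally show ?thesis .
  qed
  then show ?thesis using N that[of R] by blast
qed

text \<open>
  The demand levels \<open>f\<^sub>h\<close> enter the excess demands linearly, and the budget equations clear all
  denominators. Both weighted sums of excess demands below are polynomial identities after
  this substitution.
\<close>

lemma demand_levels:
  assumes "x > 0" "y > 0" "z > 0"
  obtains f1 f2 f3 where "excess d1 d2 d3 K L x y z = f2 + f3 - 1"
    and "excess d2 d3 d1 K L y z x = f3 + f1 - 1" and "excess d3 d1 d2 K L z x y = f1 + f2 - 1"
    and "f1 * (y + z) = d1 * x + (d3 + K) * y + (d2 + L) * z"
    and "f2 * (x + z) = (d3 + L) * x + d2 * y + (d1 + K) * z"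
    and "f3 * (x + y) = (d2 + K) * x + (d1 + L) * y + d3 * z"
proof
  let ?f1 = "(d1 * x + (d3 + K) * y + (d2 + L) * z) / (y + z)"
  let ?f2 = "((d3 + L) * x + d2 * y + (d1 + K) * z) / (x + z)"
  let ?f3 = "((d2 + K) * x + (d1 + L) * y + d3 * z) / (x + y)"
  show "excess d1 d2 d3 K L x y z = ?f2 + ?f3 - 1" "excess d2 d3 d1 K L y z x = ?f3 + ?f1 - 1"
    "excess d3 d1 d2 K L z x y = ?f1 + ?f2 - 1"
    unfolding excess_def by (simp_all add: add_ac)
  show "?f1 * (y + z) = d1 * x + (d3 + K) * y + (d2 + L) * z"
    "?f2 * (x + z) = (d3 + L) * x + d2 * y + (d1 + K) * z"
    "?f3 * (x + y) = (d2 + K) * x + (d1 + L) * y + d3 * z"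
    using assms by simp_all
qed

lemma walras:
  assumes "x > 0" "y > 0" "z > 0" and "d1 + d2 + d3 + K + L = 1"
  shows "x * excess d1 d2 d3 K L x y z + y * excess d2 d3 d1 K L y z x +
    z * excess d3 d1 d2 K L z x y = 0"
proof -
  obtain f1 f2 f3 where E: "excess d1 d2 d3 K L x y z = f2 + f3 - 1"
      "excess d2 d3 d1 K L y z x = f3 + f1 - 1" "excess d3 d1 d2 K L z x y = f1 + f2 - 1"
    and f: "f1 * (y + z) = d1 * x + (d3 + K) * y + (d2 + L) * z"
      "f2 * (x + z) = (d3 + L) * x + d2 * y + (d1 + K) * z"
      "f3 * (x + y) = (d2 + K) * x + (d1 + L) * y + d3 * z"
    using demand_levels[OF assms(1-3), of d1 d2 d3 K L] by blast
  have K: "K = 1 - d1 - d2 - d3 - L" using assms by simp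
  have "x * (f2 + f3 - 1) + y * (f3 + f1 - 1) + z * (f1 + f2 - 1)
      = f1 * (y + z) + f2 * (x + z) + f3 * (x + y) - x - y - z"
    by (simp add: algebra_simps)
  also have "\<dots> = 0"
    unfolding f K by (simp add: algebra_simps)
  finally show ?thesis unfolding E .
qed

text \<open>
  The identity behind global stability. Multiplied by \<open>x y z\<close>, the left-hand side is the sum of
  the \<open>p\<^sub>h f\<^sub>h (p \<bullet> b\<^sub>h)\<close> minus the sum of the products of two distinct prices, hence by the budget
  equations the quadratic form of \<open>A\<close> at \<open>p\<close> minus these products. As the rows and columns of \<open>A\<close>
  sum to 1, the diagonal lies in the kernel of this form, which therefore depends on the price
  differences only.
\<close>

lemma reciprocal_excess_sum:
  assumes "x > 0" "y > 0" "z > 0" and "d1 + d2 + d3 + K + L = 1"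
  shows "excess d1 d2 d3 K L x y z / x + excess d2 d3 d1 K L y z x / y +
      excess d3 d1 d2 K L z x y / z =
    (d1 * (x - z)\<^sup>2 - (d1 + d2 - d3) * (x - z) * (y - z) + d2 * (y - z)\<^sup>2) / (x * y * z)"
proof -
  obtain f1 f2 f3 where E: "excess d1 d2 d3 K L x y z = f2 + f3 - 1"
      "excess d2 d3 d1 K L y z x = f3 + f1 - 1" "excess d3 d1 d2 K L z x y = f1 + f2 - 1"
    and f: "f1 * (y + z) = d1 * x + (d3 + K) * y + (d2 + L) * z"
      "f2 * (x + z) = (d3 + L) * x + d2 * y + (d1 + K) * z"
      "f3 * (x + y) = (d2 + K) * x + (d1 + L) * y + d3 * z"
    using demand_levels[OF assms(1-3), of d1 d2 d3 K L] by blast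
  have K: "K = 1 - d1 - d2 - d3 - L" using assms by simp
  have "(f2 + f3 - 1) * (y * z) + (f3 + f1 - 1) * (x * z) + (f1 + f2 - 1) * (x * y)
      = x * (f1 * (y + z)) + y * (f2 * (x + z)) + z * (f3 * (x + y)) - x * y - x * z - y * z"
    by (simp add: algebra_simps)
  also have "\<dots> = d1 * (x - z)\<^sup>2 - (d1 + d2 - d3) * (x - z) * (y - z) + d2 * (y - z)\<^sup>2"
    unfolding f K by (simp add: power2_eq_square algebra_simps)
  finally show ?thesis unfolding E using assms by (simp add: field_simps)
qed

lemma excess_demand_eq_excess:
  assumes "A = endowment_matrix d1 d2 d3 K L" and "condition_A A"
  shows "excess_demand A p $ 1 = excess d1 d2 d3 K L (p $ 1) (p $ 2) (p $ 3)"
    and "excess_demand A p $ 2 = excess d2 d3 d1 K L (p $ 2) (p $ 3) (p $ 1)"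
    and "excess_demand A p $ 3 = excess d3 d1 d2 K L (p $ 3) (p $ 1) (p $ 2)"
  unfolding excess_demand_condition_A[OF assms(2)] unfolding assms(1)
  by (simp_all add: demand_level_def excess_def endowment_matrix_def B_def inner_vec_def sum_3
      column_def algebra_simps)

section \<open>Level surfaces of the price level\<close>

definition power_primitive :: "real \<Rightarrow> real \<Rightarrow> real" where
  "power_primitive a x = (if a = 0 then ln x else x powr a / a)"

lemma has_real_derivative_power_primitive:
  assumes "x > 0"
  shows "(power_primitive a has_real_derivative x powr (a - 1)) (at x within S)"
proof (cases "a = 0")
  case True
  have "(ln has_real_derivative x powr (- 1)) (at x within S)"
    using assms by (auto intro!: derivative_eq_intros simp: powr_minus divide_simps)
  then show ?thesis using True by (simp add: power_primitive_def[abs_def])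
next
  case False
  have "((\<lambda>x. x powr a / a) has_real_derivative x powr (a - 1)) (at x within S)"
    using assms False by (auto intro!: derivative_eq_intros)
  then show ?thesis using False by (simp add: power_primitive_def[abs_def])
qed

lemma power_primitive_less_iff:
  assumes "x > 0" and "y > 0"
  shows "power_primitive a x < power_primitive a y \<longleftrightarrow> x < y"
proof -
  have less: "power_primitive a x < power_primitive a y" if "0 < x" "x < y" for x y
  proof (rule DERIV_pos_imp_increasing[OF \<open>x < y\<close>])
    fix t assume "x \<le> t"
    then have "0 < t" using that by simp
    then show "\<exists>l. DERIV (power_primitive a) t :> l \<and> 0 < l"
      using has_real_derivative_power_primitive[of t a UNIV] by (intro exI[of _ "t powr (a - 1)"]) auto
  qed
  show ?thesis
    using less[of x y] less[of y x] assms by (cases x y rule: linorder_cases) auto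
qed

lemma power_primitive_le_iff:
  assumes "x > 0" and "y > 0"
  shows "power_primitive a x \<le> power_primitive a y \<longleftrightarrow> x \<le> y"
  using power_primitive_less_iff[OF assms(2,1), of a] by (simp add: not_less[symmetric])

lemma power_primitive_surj:
  assumes "a = 0 \<or> a * c > 0"
  obtains s where "s > 0" and "power_primitive a s = c"
proof (cases "a = 0")
  case True
  then show ?thesis using that[of "exp c"] by (simp add: power_primitive_def)
next
  case False
  then have "c \<noteq> 0" using assms by auto
  then show ?thesis
    using False assms that[of "(a * c) powr (1 / a)"] by (auto simp: power_primitive_def powr_powr)
qed

lemma continuous_power_primitive:
  assumes "x > 0"
  shows "continuous (at x within S) (power_primitive a)"
  using has_real_derivative_power_primitive[OF assms] by (rule DERIV_continuous)

lemma price_level_eq_sum_power_primitive: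
  "price_level \<gamma> p = (\<Sum>i\<in>UNIV. power_primitive (2 - \<gamma>) (p $ i))"
  unfolding price_level_def power_primitive_def by (intro sum.cong) auto

text \<open>
  By the third property a price vector of level \<open>c\<close> with one price equal to \<open>m\<close> has another
  price of at least \<open>R m\<close>. For \<open>a \<ge> 0\<close> any sufficiently small \<open>m\<close> will do. For \<open>a < 0\<close> the
  primitive is negative, so each single price exceeds the point \<open>s\<close> where the primitive equals
  \<open>c\<close>, and \<open>m\<close> is chosen slightly above \<open>s\<close>. Then a very large price and one of at least \<open>m\<close>
  together contribute more than \<open>c\<close>, so that the remaining price has to make up a negative
  difference and stays bounded; this is the use of the last property.
\<close>

lemma level_lower_bound:
  fixes x0 :: "real^3" and a R :: real
  assumes x0: "\<forall>i. 0 < x0 $ i" and R: "R \<ge> 1"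
  defines "c \<equiv> \<Sum>i\<in>UNIV. power_primitive a (x0 $ i)"
  obtains m where "0 < m" and "\<forall>i. m < x0 $ i"
    and "power_primitive a m + 2 * power_primitive a (R * m) < c"
    and "a < 0 \<longrightarrow> c < power_primitive a m"
proof (cases "a < 0")
  case False
  have "c > 0" if "a \<noteq> 0"
  proof -
    have "a > 0" using False that by simp
    then show ?thesis
      unfolding c_def power_primitive_def
      using x0 by (auto intro!: sum_pos divide_pos_pos simp: less_imp_neq[THEN not_sym])
  qed
  then have "a = 0 \<or> a * (c / 3) > 0" using False by (cases "a = 0") auto
  then obtain s where s: "s > 0" "power_primitive a s = c / 3"
    by (rule power_primitive_surj)
  define t where "t = min s (Min (range (\<lambda>i. x0 $ i)))"
  have t: "t > 0" "t \<le> s" "\<forall>i. t \<le> x0 $ i"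
    using s x0 by (auto simp: t_def min_le_iff_disj)
  define m where "m = t / (2 * R)"
  have m: "m > 0" "R * m < s" "m < s" "\<forall>i. m < x0 $ i"
  proof -
    show "m > 0" "R * m < s" using t R by (auto simp: m_def)
    have "m < t" using t R by (simp add: m_def field_simps add_strict_increasing)
    then show "m < s" "\<forall>i. m < x0 $ i" using t by (auto intro: less_le_trans)
  qed
  have "power_primitive a m < c / 3" "power_primitive a (R * m) < c / 3"
    using power_primitive_less_iff[of m s a] power_primitive_less_iff[of "R * m" s a] m s R by simp_all
  then show ?thesis using that[of m] m False by auto
next
  case True
  have neg: "power_primitive a x < 0" if "x > 0" for x
    using that True by (simp add: power_primitive_def divide_pos_neg)
  have sum_neg: "(\<Sum>i\<in>S. power_primitive a (x0 $ i)) < 0" if "S \<noteq> {}" for S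
    using sum_strict_mono[of S "\<lambda>i. power_primitive a (x0 $ i)" "\<lambda>i. 0"] that neg x0 by simp
  have "c < 0" unfolding c_def by (rule sum_neg) simp
  then have "a = 0 \<or> a * c > 0" using True by (auto simp: mult_neg_neg)
  then obtain s where s: "s > 0" "power_primitive a s = c"
    by (rule power_primitive_surj)
  have "s < x0 $ i" for i
  proof -
    have "c < power_primitive a (x0 $ i)"
    proof -
      have "UNIV - {i} \<noteq> {}" using zero_neq_one[where 'a = 3] by (metis Diff_eq_empty_iff UNIV_I singletonD subsetD)
      then show ?thesis unfolding c_def using sum_neg by (subst sum.remove[of _ i]) auto
    qed
    then show ?thesis using power_primitive_less_iff[of s "x0 $ i" a] s x0 by simp
  qed
  then have s_less: "\<forall>\<^sub>F m in at_right s. \<forall>i. m < x0 $ i"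
    by (intro eventually_all_finite) (auto intro: eventually_at_rightI)
  have "((\<lambda>m. power_primitive a (R * m)) \<longlongrightarrow> power_primitive a (R * s)) (at_right s)"
    by (rule isCont_tendsto_compose[OF continuous_power_primitive[of "R * s" UNIV a]])
      (use s R in \<open>auto intro!: tendsto_intros\<close>)
  moreover have "(power_primitive a \<longlongrightarrow> power_primitive a s) (at_right s)"
    using continuous_power_primitive[OF s(1)] by (simp add: continuous_within)
  ultimately have "((\<lambda>m. power_primitive a m + 2 * power_primitive a (R * m)) \<longlongrightarrow>
      power_primitive a s + 2 * power_primitive a (R * s)) (at_right s)"
    by (intro tendsto_intros)
  moreover have "power_primitive a s + 2 * power_primitive a (R * s) < c"
    using s R neg[of "R * s"] by simp
  ultimately have "\<forall>\<^sub>F m in at_right s. power_primitive a m + 2 * power_primitive a (R * m) < c"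
    by (rule order_tendstoD)
  with s_less have "\<forall>\<^sub>F m in at_right s. (\<forall>i. m < x0 $ i) \<and>
      power_primitive a m + 2 * power_primitive a (R * m) < c \<and> s < m"
    using eventually_at_right_less[of s] by eventually_elim auto
  then obtain m where m: "\<forall>i. m < x0 $ i" "s < m"
    "power_primitive a m + 2 * power_primitive a (R * m) < c"
    using eventually_happens[of _ "at_right s"] by (auto simp: trivial_limit_at_right_real)
  moreover have "c < power_primitive a m"
    using power_primitive_less_iff[of s m a] m s by simp
  ultimately show ?thesis using that[of m] s by auto
qed

text \<open>
  On the level surface of \<open>x0\<close> within \<open>[m, \<infinity>)\<^sup>3\<close>, a price equal to \<open>m\<close> is small relative to some
  other price, and a price equal to \<open>M\<close> is large relative to both others. For \<open>\<gamma> \<le> 2\<close> the second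
  claim holds because no price on the surface is as large as \<open>M\<close>. For \<open>\<gamma> > 2\<close> the surface
  is unbounded, but only one price at a time can be large: the other two are at most \<open>P\<close>.
\<close>

lemma trapping_box:
  fixes x0 :: "real^3" and \<gamma> R :: real
  assumes x0: "\<forall>i. 0 < x0 $ i" and R: "R \<ge> 1"
  obtains m M where "0 < m" and "\<forall>i. m < x0 $ i \<and> x0 $ i < M"
    and "\<And>x i. \<lbrakk>\<forall>j. m \<le> x $ j; price_level \<gamma> x = price_level \<gamma> x0; x $ i = m\<rbrakk>
      \<Longrightarrow> \<exists>j. R * m \<le> x $ j"
    and "\<And>x i j. \<lbrakk>\<forall>j. m \<le> x $ j; price_level \<gamma> x = price_level \<gamma> x0; x $ i = M; j \<noteq> i\<rbrakk>
      \<Longrightarrow> R * x $ j \<le> M"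
proof -
  define a where "a = 2 - \<gamma>"
  define c where "c = price_level \<gamma> x0"
  have c_eq: "c = (\<Sum>i\<in>UNIV. power_primitive a (x0 $ i))"
    by (simp add: c_def a_def price_level_eq_sum_power_primitive)
  let ?\<psi> = "power_primitive a"
  obtain m where m: "0 < m" "\<forall>i. m < x0 $ i" "?\<psi> m + 2 * ?\<psi> (R * m) < c" "a < 0 \<longrightarrow> c < ?\<psi> m"
    by (rule level_lower_bound[OF x0 R, of a, folded c_eq])
  have split: "price_level \<gamma> x = ?\<psi> (x $ i) + ?\<psi> (x $ j) + ?\<psi> (x $ k)"
    if "i \<noteq> j" "j \<noteq> k" "i \<noteq> k" for x :: "real^3" and i j k
  proof -
    have "{i, j, k} = UNIV"
      using that by (intro card_subset_eq) auto
    from this[symmetric] show ?thesis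
      unfolding price_level_eq_sum_power_primitive a_def[symmetric]
      by (rule ssubst) (use that in \<open>simp add: add_ac\<close>)
  qed
  have third: "\<exists>k. j \<noteq> k \<and> i \<noteq> k" for i j :: 3
  proof -
    have "card {i, j} < card (UNIV :: 3 set)" by (simp add: card_insert_if)
    then have "{i, j} \<noteq> UNIV" by auto
    then show ?thesis by auto
  qed
  have others: "\<exists>j k. i \<noteq> j \<and> j \<noteq> k \<and> i \<noteq> k" for i :: 3
    using third by metis
  have low: "\<exists>j. R * m \<le> x $ j"
    if "\<forall>j. m \<le> x $ j" "price_level \<gamma> x = price_level \<gamma> x0" "x $ i = m" for x :: "real^3" and i
  proof (rule ccontr)
    assume "\<not> ?thesis"
    then have "?\<psi> (x $ j) < ?\<psi> (R * m)" for j
      using that(1) m(1) R by (subst power_primitive_less_iff) (auto simp: not_le intro: less_le_trans)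
    moreover obtain j k where "i \<noteq> j" "j \<noteq> k" "i \<noteq> k" using others by blast
    ultimately show False using m(3) split[of i j k x] that c_def
      by (smt (verit))
  qed
  \<comment> \<open>for \<open>a < 0\<close>, a pair of prices above \<open>P\<close> has a level above \<open>c - ?\<psi> m\<close>, which leaves less
      than \<open>?\<psi> m\<close> for the third; otherwise a single price above \<open>P\<close>, with the other two at
      least \<open>m\<close>, already exceeds the level \<open>c\<close>\<close>
  obtain P where P: "P > 0"
    "if a < 0 then ?\<psi> P = (c - ?\<psi> m) / 2 else ?\<psi> P + 2 * ?\<psi> m > c"
  proof (cases "a < 0")
    case True
    then have "a = 0 \<or> a * ((c - ?\<psi> m) / 2) > 0"
      using m(4) by (intro disjI2 mult_neg_neg) auto
    then show ?thesis using that True by (elim power_primitive_surj) auto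
  next
    case False
    let ?t = "max 1 (c - 2 * ?\<psi> m + 1)"
    have "?t > 0" by linarith
    then have "a = 0 \<or> a * ?t > 0"
      using False mult_pos_pos[of a ?t] by fastforce
    then obtain P where "P > 0" "?\<psi> P = ?t" by (rule power_primitive_surj)
    moreover have "?t > c - 2 * ?\<psi> m" by linarith
    ultimately show ?thesis using that False by auto
  qed
  define M where "M = max (R * P) (Max (range (\<lambda>i. x0 $ i))) + 1"
  have "x0 $ i < M" for i
  proof -
    have "x0 $ i \<le> Max (range (\<lambda>i. x0 $ i))" by (intro Max_ge) auto
    then show ?thesis unfolding M_def by linarith
  qed
  have "R * P < M" by (simp add: M_def)
  moreover have "P \<le> R * P" using P(1) R by simp
  ultimately have "P < M" by simp
  then have PM: "?\<psi> P < ?\<psi> M" using P(1) by (simp add: power_primitive_less_iff)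
  have high: "R * x $ j \<le> M"
    if "\<forall>j. m \<le> x $ j" "price_level \<gamma> x = price_level \<gamma> x0" "x $ i = M" "j \<noteq> i" for x :: "real^3" and i j
  proof -
    obtain k where k: "j \<noteq> k" "i \<noteq> k" using third by blast
    have x: "0 < x $ j" for j using that(1) m(1) by (auto intro: less_le_trans)
    then have ge: "?\<psi> m \<le> ?\<psi> (x $ j)" for j using that(1) m(1) by (simp add: power_primitive_le_iff)
    have sum: "?\<psi> M + ?\<psi> (x $ j) + ?\<psi> (x $ k) = c"
      using split[of i j k x] k that c_def by auto
    have "a < 0"
      using sum P(2) PM ge[of j] ge[of k] by (auto split: if_splits)
    then have "?\<psi> (x $ j) \<le> ?\<psi> P"
      using sum P(2) PM ge[of k] by (auto simp: field_simps)
    then have "x $ j \<le> P" using x P(1) by (simp add: power_primitive_le_iff)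
    then have "R * x $ j \<le> R * P" using R by (intro mult_left_mono) auto
    then show ?thesis using \<open>R * P < M\<close> by simp
  qed
  show ?thesis
  proof (rule that[of m M])
    show "\<forall>i. m < x0 $ i \<and> x0 $ i < M"
      using m(2) \<open>\<And>i. x0 $ i < M\<close> by blast
    show "\<exists>j. R * m \<le> x $ j"
      if "\<forall>j. m \<le> x $ j" "price_level \<gamma> x = price_level \<gamma> x0" "x $ i = m" for x :: "real^3" and i
      using that by (rule low)
    show "R * x $ j \<le> M"
      if "\<forall>j. m \<le> x $ j" "price_level \<gamma> x = price_level \<gamma> x0" "x $ i = M" "j \<noteq> i" for x :: "real^3" and i j
      using that by (rule high)
  qed (fact m(1))
qed

section \<open>Lipschitz continuity of the price field\<close>

lemma ex_lipschitz_on_mult: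
  fixes f g :: "'a::metric_space \<Rightarrow> real"
  assumes "compact S" and "\<exists>L. L-lipschitz_on S f" and "\<exists>L. L-lipschitz_on S g"
  shows "\<exists>L. L-lipschitz_on S (\<lambda>x. f x * g x)"
proof -
  obtain L M where f: "L-lipschitz_on S f" and g: "M-lipschitz_on S g"
    using assms by blast
  have "bounded (f ` S)" "bounded (g ` S)"
    using assms(1) f g by (auto intro!: compact_imp_bounded compact_continuous_image lipschitz_on_continuous_on)
  then obtain C D where C: "C > 0" "\<And>x. x \<in> S \<Longrightarrow> \<bar>f x\<bar> \<le> C" and D: "D > 0" "\<And>x. x \<in> S \<Longrightarrow> \<bar>g x\<bar> \<le> D"
    unfolding bounded_pos by auto
  have "(C * M + D * L)-lipschitz_on S (\<lambda>x. f x * g x)"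
  proof (rule lipschitz_onI)
    fix x y assume xy: "x \<in> S" "y \<in> S"
    have "\<bar>f x * g x - f y * g y\<bar> = \<bar>f x * (g x - g y) + g y * (f x - f y)\<bar>"
      by (simp add: algebra_simps)
    also have "\<dots> \<le> \<bar>f x\<bar> * \<bar>g x - g y\<bar> + \<bar>g y\<bar> * \<bar>f x - f y\<bar>"
      by (simp flip: abs_mult)
    also have "\<dots> \<le> C * (M * dist x y) + D * (L * dist x y)"
      using lipschitz_onD[OF f xy] lipschitz_onD[OF g xy] xy C D
      by (intro add_mono mult_mono) (auto simp: dist_real_def)
    finally show "dist (f x * g x) (f y * g y) \<le> (C * M + D * L) * dist x y"
      by (simp add: dist_real_def algebra_simps)
  qed (use C D lipschitz_on_nonneg[OF f] lipschitz_on_nonneg[OF g] in auto)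
  then show ?thesis by blast
qed

lemma ex_lipschitz_on_add:
  fixes f g :: "'a::metric_space \<Rightarrow> real"
  shows "\<exists>L. L-lipschitz_on S f \<Longrightarrow> \<exists>L. L-lipschitz_on S g \<Longrightarrow> \<exists>L. L-lipschitz_on S (\<lambda>x. f x + g x)"
  by (blast intro: lipschitz_on_add)

lemma ex_lipschitz_on_compose_C1:
  fixes h :: "real \<Rightarrow> real"
  assumes "\<exists>L. L-lipschitz_on S f" and "\<And>x. x \<in> S \<Longrightarrow> f x \<in> {a..b}"
    and "\<And>s. s \<in> {a..b} \<Longrightarrow> (h has_real_derivative h' s) (at s)" and "continuous_on {a..b} h'"
  shows "\<exists>L. L-lipschitz_on S (\<lambda>x. h (f x))"
proof -
  obtain L where f: "L-lipschitz_on S f" using assms(1) by blast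
  have "bounded (h' ` {a..b})"
    using assms(4) by (intro compact_imp_bounded compact_continuous_image) auto
  then obtain C where C: "C > 0" "\<And>s. s \<in> {a..b} \<Longrightarrow> norm (h' s) \<le> C"
    unfolding bounded_pos by auto
  have "C-lipschitz_on {a..b} h"
  proof (rule lipschitz_onI)
    show "dist (h s) (h t) \<le> C * dist s t" if "s \<in> {a..b}" "t \<in> {a..b}" for s t
      unfolding dist_norm using that C assms(3)
      by (intro field_differentiable_bound[where f' = h' and S = "{a..b}"]) 
        (auto intro: has_field_derivative_at_within)
  qed (use C in auto)
  then have "C-lipschitz_on (f ` S) h"
    by (rule lipschitz_on_subset) (use assms(2) in auto)
  then show ?thesis using lipschitz_on_compose2[OF f] by blast
qed

lemma ex_lipschitz_on_vec:
  fixes f :: "'a::metric_space \<Rightarrow> real^'n"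
  assumes "\<And>i. \<exists>L. L-lipschitz_on S (\<lambda>x. f x $ i)"
  shows "\<exists>L. L-lipschitz_on S f"
proof -
  obtain L where L: "\<And>i. (L i)-lipschitz_on S (\<lambda>x. f x $ i)" using assms by metis
  have "(\<Sum>i\<in>UNIV. L i)-lipschitz_on S f"
  proof (rule lipschitz_onI)
    fix x y assume xy: "x \<in> S" "y \<in> S"
    have "dist (f x) (f y) \<le> (\<Sum>i\<in>UNIV. \<bar>f x $ i - f y $ i\<bar>)"
      using norm_le_l1_cart[of "f x - f y"] by (simp add: dist_norm)
    also have "\<dots> \<le> (\<Sum>i\<in>UNIV. L i * dist x y)"
      using lipschitz_onD[OF L xy] by (intro sum_mono) (simp add: dist_real_def)
    finally show "dist (f x) (f y) \<le> (\<Sum>i\<in>UNIV. L i) * dist x y"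
      by (simp add: sum_distrib_right)
  qed (auto intro: sum_nonneg lipschitz_on_nonneg[OF L])
  then show ?thesis by blast
qed

lemma mem_cbox_vec: "(p :: real^'n) \<in> cbox (vec m) (vec M) \<longleftrightarrow> (\<forall>i. m \<le> p $ i \<and> p $ i \<le> M)"
  by (simp add: mem_box_cart)

text \<open>
  On the box all prices and all bundle values \<open>p \<bullet> b\<^sub>h\<close> stay away from 0, so powers and quotients
  are smooth there.
\<close>

lemma price_field_lipschitz_on_box:
  assumes "0 < m"
  shows "\<exists>L. L-lipschitz_on (cbox (vec m) (vec M)) (price_field \<gamma> A)"
proof (rule ex_lipschitz_on_vec)
  fix i
  let ?S = "cbox (vec m) (vec M) :: (real^3) set"
  have inner: "\<exists>L. L-lipschitz_on ?S (\<lambda>p. p \<bullet> v)" for v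
    using bounded_linear.lipschitz_boundE[OF bounded_linear_inner_left] by blast
  have comp: "\<exists>L. L-lipschitz_on ?S (\<lambda>p. p $ i)"
    using inner[of "axis i 1"] by (simp add: inner_axis)
  have pow: "\<exists>L. L-lipschitz_on ?S (\<lambda>p. (p $ i) powr \<gamma>)"
    by (rule ex_lipschitz_on_compose_C1[OF comp, where a = m and b = M and h' = "\<lambda>s. \<gamma> * s powr (\<gamma> - 1)"])
      (use assms in \<open>auto simp: mem_cbox_vec intro!: derivative_eq_intros continuous_intros\<close>)
  have inv: "\<exists>L. L-lipschitz_on ?S (\<lambda>p. inverse (p \<bullet> column h B))" for h
  proof (rule ex_lipschitz_on_compose_C1[OF inner, where a = "2 * m" and b = "2 * M" and h' = "\<lambda>s. - (inverse s ^ 2)"])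
    show "p \<bullet> column h B \<in> {2 * m..2 * M}" if "p \<in> ?S" for p
      using that exhaust_3[of h]
      by (auto simp: mem_cbox_vec inner_vec_def sum_3 column_def B_def forall_3)
  qed (use assms in \<open>auto intro!: derivative_eq_intros continuous_intros simp: power2_eq_square\<close>)
  have const: "\<exists>L. L-lipschitz_on ?S (\<lambda>p. c)" for c :: real
    by (blast intro: lipschitz_on_constant)
  have level: "\<exists>L. L-lipschitz_on ?S (\<lambda>p. demand_level A p $ h)" for h
    unfolding demand_level_def using ex_lipschitz_on_mult[OF compact_cbox inner inv]
    by (simp add: divide_inverse)
  have "\<exists>L. L-lipschitz_on ?S (\<lambda>p. (p $ i) powr \<gamma> * ((B $ i $ 1 * demand_level A p $ 1
      + B $ i $ 2 * demand_level A p $ 2 + B $ i $ 3 * demand_level A p $ 3) + - (A *v u) $ i))"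
    by (intro ex_lipschitz_on_mult ex_lipschitz_on_add compact_cbox pow level const)
  moreover have "price_field \<gamma> A p $ i = (p $ i) powr \<gamma> * ((B $ i $ 1 * demand_level A p $ 1
      + B $ i $ 2 * demand_level A p $ 2 + B $ i $ 3 * demand_level A p $ 3) + - (A *v u) $ i)" for p
    by (simp add: price_field_def excess_demand_def matrix_vector_mult_def sum_3)
  ultimately show "\<exists>L. L-lipschitz_on ?S (\<lambda>p. price_field \<gamma> A p $ i)"
    by (simp only:)
qed

section \<open>Conserved and decreasing quantities\<close>

locale stable_endowments =
  fixes A :: "real^3^3" and d1 d2 d3 K L \<gamma> :: real
  assumes cond_A: "condition_A A" and A_eq: "A = endowment_matrix d1 d2 d3 K L"
    and d_nonneg: "d1 \<ge> 0" "d2 \<ge> 0" "d3 \<ge> 0" and d_sum: "d1 + d2 + d3 + K + L = 1"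
    and H: "4 * (d1 * d2 + d2 * d3 + d3 * d1) - (d1 + d2 + d3)\<^sup>2 > 0"
begin

abbreviation "F \<equiv> price_field \<gamma> A"
abbreviation "D \<equiv> positive_prices"

text \<open>
  Each of the three differences is the number assumed positive; it does not change when
  \<open>d\<^sub>1, d\<^sub>2, d\<^sub>3\<close> are permuted.
\<close>

lemma discriminants:
  "(d2 + d3 - d1)\<^sup>2 < 4 * d2 * d3" "(d3 + d1 - d2)\<^sup>2 < 4 * d3 * d1" "(d1 + d2 - d3)\<^sup>2 < 4 * d1 * d2"
  using H by (simp_all add: power2_eq_square algebra_simps)

lemma d_pos: "d1 > 0" "d2 > 0" "d3 > 0"
proof -
  have "d2 * d3 > 0" "d3 * d1 > 0"
    using le_less_trans[OF zero_le_power2 discriminants(1)]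
      le_less_trans[OF zero_le_power2 discriminants(2)] by (auto simp: mult_ac)
  then show "d1 > 0" "d2 > 0" "d3 > 0"
    using d_nonneg by (auto simp: zero_less_mult_iff)
qed

lemmas excess_demand_eq = excess_demand_eq_excess[OF A_eq cond_A]

lemma positive_pricesD: "p \<in> D \<Longrightarrow> 0 < p $ i"
  by (simp add: positive_prices_def)

lemma excess_demand_signs:
  obtains R where "R \<ge> 1"
    and "\<And>p i j. \<lbrakk>p \<in> D; R * p $ i \<le> p $ j\<rbrakk> \<Longrightarrow> 0 < excess_demand A p $ i"
    and "\<And>p i. \<lbrakk>p \<in> D; \<And>j. j \<noteq> i \<Longrightarrow> R * p $ j \<le> p $ i\<rbrakk> \<Longrightarrow> excess_demand A p $ i < 0"
proof -
  have "d2 + d3 + d1 + K + L = 1" "d3 + d1 + d2 + K + L = 1" using d_sum by auto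
  note sums = d_sum this
  obtain R1 where R1: "R1 \<ge> 1"
    "\<And>x y z. \<lbrakk>0 < x; 0 < y; 0 < z; R1 * x \<le> max y z\<rbrakk> \<Longrightarrow> 0 < excess d1 d2 d3 K L x y z"
    using excess_pos_if_cheap[OF d_pos(2,3) discriminants(1) sums(1)] by blast
  obtain R2 where R2: "R2 \<ge> 1"
    "\<And>x y z. \<lbrakk>0 < x; 0 < y; 0 < z; R2 * x \<le> max y z\<rbrakk> \<Longrightarrow> 0 < excess d2 d3 d1 K L x y z"
    using excess_pos_if_cheap[OF d_pos(3,1) discriminants(2) sums(2)] by blast
  obtain R3 where R3: "R3 \<ge> 1"
    "\<And>x y z. \<lbrakk>0 < x; 0 < y; 0 < z; R3 * x \<le> max y z\<rbrakk> \<Longrightarrow> 0 < excess d3 d1 d2 K L x y z"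
    using excess_pos_if_cheap[OF d_pos(1,2) discriminants(3) sums(3)] by blast
  obtain S1 where S1: "S1 \<ge> 1"
    "\<And>x y z. \<lbrakk>0 < x; 0 < y; 0 < z; S1 * y \<le> x; S1 * z \<le> x\<rbrakk> \<Longrightarrow> excess d1 d2 d3 K L x y z < 0"
    using excess_neg_if_expensive[OF d_pos(1,2,3) sums(1)] by blast
  obtain S2 where S2: "S2 \<ge> 1"
    "\<And>x y z. \<lbrakk>0 < x; 0 < y; 0 < z; S2 * y \<le> x; S2 * z \<le> x\<rbrakk> \<Longrightarrow> excess d2 d3 d1 K L x y z < 0"
    using excess_neg_if_expensive[OF d_pos(2,3,1) sums(2)] by blast
  obtain S3 where S3: "S3 \<ge> 1"
    "\<And>x y z. \<lbrakk>0 < x; 0 < y; 0 < z; S3 * y \<le> x; S3 * z \<le> x\<rbrakk> \<Longrightarrow> excess d3 d1 d2 K L x y z < 0"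
    using excess_neg_if_expensive[OF d_pos(3,1,2) sums(3)] by blast
  \<comment> \<open>the sum exceeds 1, so no price exceeds itself by the factor \<open>R\<close>\<close>
  define R where "R = R1 + R2 + R3 + S1 + S2 + S3"
  have le: "R1 \<le> R" "R2 \<le> R" "R3 \<le> R" "S1 \<le> R" "S2 \<le> R" "S3 \<le> R" "1 < R"
    using R1(1) R2(1) R3(1) S1(1) S2(1) S3(1) by (auto simp: R_def)
  show ?thesis
  proof
    show "R \<ge> 1" using le by simp
    show "0 < excess_demand A p $ i" if p: "p \<in> D" and ij: "R * p $ i \<le> p $ j" for p i j
    proof -
      have pos: "0 < p $ k" for k using p by (rule positive_pricesD)
      have "p $ i < R * p $ i" using le pos by simp
      then have "i \<noteq> j" using ij by auto
      have "r * p $ i \<le> p $ j" if "r \<le> R" for r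
        using ij mult_right_mono[OF that less_imp_le[OF pos]] by (rule order_trans[rotated])
      note le(1-3)[THEN this]
      then show ?thesis
        using exhaust_3[of i] exhaust_3[of j] \<open>i \<noteq> j\<close> pos
        by (auto simp: excess_demand_eq intro!: R1(2) R2(2) R3(2))
    qed
    show "excess_demand A p $ i < 0" if p: "p \<in> D" and i: "\<And>j. j \<noteq> i \<Longrightarrow> R * p $ j \<le> p $ i" for p i
    proof -
      have pos: "0 < p $ k" for k using p by (rule positive_pricesD)
      have "r * p $ j \<le> p $ i" if "r \<le> R" "j \<noteq> i" for r j
        using i[OF that(2)] mult_right_mono[OF that(1) less_imp_le[OF pos]] by (rule order_trans[rotated])
      note le(4-6)[THEN this]
      then show ?thesis
        using exhaust_3[of i] pos by (auto simp: excess_demand_eq intro!: S1(2) S2(2) S3(2))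
    qed
  qed
qed

text \<open>
  Half the sum of the three terms \<open>(d\<^sub>i + d\<^sub>j - d\<^sub>k) (p\<^sub>i - p\<^sub>j)\<^sup>2\<close>. One of these coefficients may be
  negative, so definiteness is read off from the two independent differences instead.
\<close>

definition dispersion :: "real^3 \<Rightarrow> real" where
  "dispersion p = d1 * (p $ 1 - p $ 3)\<^sup>2 - (d1 + d2 - d3) * (p $ 1 - p $ 3) * (p $ 2 - p $ 3)
     + d2 * (p $ 2 - p $ 3)\<^sup>2"

lemma dispersion_pos: "p $ 1 \<noteq> p $ 3 \<or> p $ 2 \<noteq> p $ 3 \<Longrightarrow> 0 < dispersion p"
  unfolding dispersion_def
  using d_pos discriminants by (intro positive_binary_quadratic) auto

lemma dispersion_nonneg: "0 \<le> dispersion p"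
  using dispersion_pos[of p] by (cases "p $ 1 \<noteq> p $ 3 \<or> p $ 2 \<noteq> p $ 3") (auto simp: dispersion_def)

lemma dispersion_eq_0D: "dispersion p = 0 \<Longrightarrow> p = p $ 3 *\<^sub>R p_star"
  using dispersion_pos[of p] by (auto simp: vec_eq_iff forall_3 p_star_def)

lemma walras_law: "p \<in> D \<Longrightarrow> (\<Sum>i\<in>UNIV. p $ i * excess_demand A p $ i) = 0"
  using walras[OF _ _ _ d_sum, of "p $ 1" "p $ 2" "p $ 3"]
  by (simp add: sum_3 excess_demand_eq positive_pricesD)

lemma sum_excess_demand_over_price:
  "p \<in> D \<Longrightarrow> (\<Sum>i\<in>UNIV. excess_demand A p $ i / p $ i) = dispersion p / (p $ 1 * p $ 2 * p $ 3)"
  using reciprocal_excess_sum[OF _ _ _ d_sum, of "p $ 1" "p $ 2" "p $ 3"]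
  by (simp add: sum_3 excess_demand_eq positive_pricesD dispersion_def)

lemma excess_demand_diagonal:
  assumes "s > 0" shows "excess_demand A (s *\<^sub>R p_star) = 0"
proof -
  have "excess a b c K L s s s = 0" if "a + b + c + K + L = 1" for a b c
  proof -
    have "excess a b c K L s s s = (a + b + c + K + L) * s / (2 * s) + (a + b + c + K + L) * s / (2 * s) - 1"
      by (simp add: excess_def algebra_simps)
    then show ?thesis using assms that by simp
  qed
  then show ?thesis
    using d_sum by (simp add: vec_eq_iff forall_3 excess_demand_eq p_star_def)
qed

lemma equilibrium_iff:
  assumes "e \<in> D"
  shows "F e = 0 \<longleftrightarrow> (\<exists>s>0. e = s *\<^sub>R p_star)"
proof
  assume "F e = 0"
  then have "excess_demand A e $ i = 0" for i
    using positive_pricesD[OF assms, of i] by (auto simp: price_field_def vec_eq_iff dest: spec[of _ i])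
  then have "dispersion e / (e $ 1 * e $ 2 * e $ 3) = 0"
    using sum_excess_demand_over_price[OF assms] by simp
  then have "dispersion e = 0"
    using positive_pricesD[OF assms] by (simp add: less_imp_neq[THEN not_sym])
  then show "\<exists>s>0. e = s *\<^sub>R p_star"
    using dispersion_eq_0D positive_pricesD[OF assms, of 3] by blast
next
  assume "\<exists>s>0. e = s *\<^sub>R p_star"
  then have "excess_demand A e = 0" using excess_demand_diagonal by auto
  then show "F e = 0" by (simp add: price_field_def vec_eq_iff)
qed

text \<open>
  A weight \<open>p\<^sub>i powr (a - 1)\<close> combines with the factor \<open>p\<^sub>i powr \<gamma>\<close> of the equation. Taking \<open>a = 2 - \<gamma>\<close>
  leaves \<open>\<Sum> p\<^sub>i E\<^sub>i = 0\<close>, and \<open>a = - \<gamma>\<close> leaves \<open>\<Sum> E\<^sub>i / p\<^sub>i \<ge> 0\<close>; this is why the result does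
  not depend on \<open>\<gamma>\<close>.
\<close>

lemma has_derivative_power_sum:
  assumes p: "(p has_vector_derivative F (p t)) (at t within I)" and pos: "p t \<in> D"
  shows "((\<lambda>t. \<Sum>i\<in>UNIV. power_primitive a (p t $ i)) has_real_derivative
    (\<Sum>i\<in>UNIV. (p t $ i) powr (a - 1 + \<gamma>) * excess_demand A (p t) $ i)) (at t within I)"
proof (rule DERIV_sum)
  fix i
  have "((\<lambda>t. p t $ i) has_real_derivative F (p t) $ i) (at t within I)"
    using bounded_linear.has_vector_derivative[OF bounded_linear_vec_nth p]
    by (simp add: has_real_derivative_iff_has_vector_derivative)
  from DERIV_chain2[OF has_real_derivative_power_primitive[OF positive_pricesD[OF pos]] this]
  have "((\<lambda>t. power_primitive a (p t $ i)) has_real_derivative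
      (p t $ i) powr (a - 1) * F (p t) $ i) (at t within I)" .
  then show "((\<lambda>t. power_primitive a (p t $ i)) has_real_derivative
      (p t $ i) powr (a - 1 + \<gamma>) * excess_demand A (p t) $ i) (at t within I)"
    by (simp add: price_field_def powr_add mult_ac)
qed

lemma price_level_derivative:
  assumes "(p has_vector_derivative F (p t)) (at t within I)" and "p t \<in> D"
  shows "((\<lambda>t. price_level \<gamma> (p t)) has_real_derivative 0) (at t within I)"
proof -
  have "(\<Sum>i\<in>UNIV. (p t $ i) powr (2 - \<gamma> - 1 + \<gamma>) * excess_demand A (p t) $ i) = 0"
    using walras_law[OF assms(2)] positive_pricesD[OF assms(2)] by (simp add: less_imp_le)
  then show ?thesis
    using has_derivative_power_sum[OF assms, of "2 - \<gamma>"]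
    by (simp add: price_level_eq_sum_power_primitive)
qed

lemma price_level_constant:
  assumes sol: "ode_solution_on F D I p" and "s \<le> t" and "{s..t} \<subseteq> I"
  shows "price_level \<gamma> (p t) = price_level \<gamma> (p s)"
proof -
  have d: "((\<lambda>t. price_level \<gamma> (p t)) has_real_derivative 0) (at r within I)" if "r \<in> {s..t}" for r
    using that assms by (intro price_level_derivative) (auto simp: ode_solution_on_def)
  have "price_level \<gamma> (p t) \<le> price_level \<gamma> (p s)"
    using assms d by (intro nonincreasing_on_interval[where f = "\<lambda>t. price_level \<gamma> (p t)" and f' = "\<lambda>_. 0" and I = I]) auto
  moreover have "- price_level \<gamma> (p t) \<le> - price_level \<gamma> (p s)"
    using assms DERIV_minus[OF d]
    by (intro nonincreasing_on_interval[where f = "\<lambda>t. - price_level \<gamma> (p t)" and f' = "\<lambda>_. 0" and I = I]) auto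
  ultimately show ?thesis by simp
qed

text \<open>
  The decreasing quantity \<open>- \<Sum> power_primitive (- \<gamma>) (p\<^sub>i)\<close>, to which a multiple of the conserved price
  level is added so that the sum has a critical point at \<open>(s, s, s)\<close>.
\<close>

definition potential :: "real \<Rightarrow> real^3 \<Rightarrow> real" where
  "potential s p =
     (\<Sum>i\<in>UNIV. power_primitive (2 - \<gamma>) (p $ i) / s\<^sup>2 - power_primitive (- \<gamma>) (p $ i))"

lemma potential_derivative:
  assumes "(p has_vector_derivative F (p t)) (at t within I)" and "p t \<in> D"
  shows "((\<lambda>t. potential s (p t)) has_real_derivative
    - (dispersion (p t) / (p t $ 1 * p t $ 2 * p t $ 3))) (at t within I)"
proof -
  have eq: "potential s x = price_level \<gamma> x / s\<^sup>2 - (\<Sum>i\<in>UNIV. power_primitive (- \<gamma>) (x $ i))" for x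
    by (simp add: potential_def price_level_eq_sum_power_primitive sum_subtractf sum_divide_distrib)
  have "(\<Sum>i\<in>UNIV. (p t $ i) powr (- \<gamma> - 1 + \<gamma>) * excess_demand A (p t) $ i) =
      (\<Sum>i\<in>UNIV. excess_demand A (p t) $ i / p t $ i)"
    using positive_pricesD[OF assms(2)] by (intro sum.cong) (auto simp: powr_minus divide_simps less_imp_le)
  then have "((\<lambda>t. \<Sum>i\<in>UNIV. power_primitive (- \<gamma>) (p t $ i)) has_real_derivative
      dispersion (p t) / (p t $ 1 * p t $ 2 * p t $ 3)) (at t within I)"
    using has_derivative_power_sum[OF assms, of "- \<gamma>"] sum_excess_demand_over_price[OF assms(2)] by simp
  from DERIV_diff[OF DERIV_cdivide[OF price_level_derivative[OF assms], of "s\<^sup>2"] this]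
  show ?thesis by (simp add: eq)
qed

lemma potential_nonincreasing:
  assumes sol: "ode_solution_on F D I p" and "r \<le> t" and "{r..t} \<subseteq> I"
  shows "potential s (p t) \<le> potential s (p r)"
proof (rule nonincreasing_on_interval[where f = "\<lambda>t. potential s (p t)" and I = I])
  fix q assume "q \<in> {r..t}"
  then have q: "(p has_vector_derivative F (p q)) (at q within I)" "p q \<in> D"
    using assms by (auto simp: ode_solution_on_def)
  from potential_derivative[OF q]
  show "((\<lambda>t. potential s (p t)) has_real_derivative
    - (dispersion (p q) / (p q $ 1 * p q $ 2 * p q $ 3))) (at q within I)" .
  show "- (dispersion (p q) / (p q $ 1 * p q $ 2 * p q $ 3)) \<le> 0"
    using dispersion_nonneg positive_pricesD[OF q(2)] by (simp add: less_imp_le)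
qed (use assms in auto)

end

section \<open>Trapping boxes and global solutions\<close>

context stable_endowments
begin

lemma box_subset_positive_prices: "0 < m \<Longrightarrow> cbox (vec m) (vec M) \<subseteq> D"
  by (auto simp: mem_cbox_vec positive_prices_def intro: less_le_trans)

text \<open>
  At the first time when a curve reaches the boundary of the box, the price level still has its
  initial value. If the price of commodity \<open>i\<close> is then \<open>m\<close>, it is cheap relative to some other, so its
  excess demand is positive and its price was below \<open>m\<close> just before; if it is \<open>M\<close>, the excess demand
  is negative and the price was above \<open>M\<close> just before.
\<close>

lemma trapping_region:
  assumes p0: "p0 \<in> D"
  obtains m M where "0 < m" and "p0 \<in> cbox (vec m) (vec M)"
    and "traps F (cbox (vec m) (vec M)) p0"
proof -
  obtain R where R: "R \<ge> 1"
    and E_pos: "\<And>p i j. \<lbrakk>p \<in> D; R * p $ i \<le> p $ j\<rbrakk> \<Longrightarrow> 0 < excess_demand A p $ i"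
    and E_neg: "\<And>p i. \<lbrakk>p \<in> D; \<And>j. j \<noteq> i \<Longrightarrow> R * p $ j \<le> p $ i\<rbrakk> \<Longrightarrow> excess_demand A p $ i < 0"
    using excess_demand_signs by blast
  obtain m M where m: "0 < m" and p0_box: "\<forall>i. m < p0 $ i \<and> p0 $ i < M"
    and low: "\<And>x i. \<lbrakk>\<forall>j. m \<le> x $ j; price_level \<gamma> x = price_level \<gamma> p0; x $ i = m\<rbrakk>
      \<Longrightarrow> \<exists>j. R * m \<le> x $ j"
    and high: "\<And>x i j. \<lbrakk>\<forall>j. m \<le> x $ j; price_level \<gamma> x = price_level \<gamma> p0; x $ i = M; j \<noteq> i\<rbrakk>
      \<Longrightarrow> R * x $ j \<le> M"
    using trapping_box[of p0 R \<gamma>] R positive_pricesD[OF p0] by blast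
  let ?K = "cbox (vec m) (vec M) :: (real^3) set"
  have stay: "p T \<in> ?K"
    if T: "0 \<le> T" and init: "p 0 = p0"
      and deriv: "\<And>t. t \<in> {0..T} \<Longrightarrow> (p has_vector_derivative v t) (at t within {0..T})"
      and v: "\<And>t. \<lbrakk>t \<in> {0..T}; p t \<in> ?K\<rbrakk> \<Longrightarrow> v t = F (p t)" for p v T
  proof (rule ccontr)
    assume "p T \<notin> ?K"
    have cont: "continuous_on {0..T} p"
      using deriv by (rule continuous_on_vector_derivative)
    define S where "S = {t \<in> {0..T}. p t \<notin> box (vec m) (vec M)}"
    have "S = {0..T} \<inter> p -` (- box (vec m) (vec M))"
      by (auto simp: S_def)
    then have "closed S"
      by (simp only:) (intro continuous_closed_preimage cont closed_Compl open_box closed_atLeastAtMost)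
    have "T \<in> S"
      using T \<open>p T \<notin> ?K\<close> box_subset_cbox[of "vec m" "vec M :: real^3"] by (auto simp: S_def)
    define t1 where "t1 = Inf S"
    have bdd: "bdd_below S" by (auto simp: S_def bdd_below_def)
    then have t1: "t1 \<in> S"
      unfolding t1_def using \<open>closed S\<close> \<open>T \<in> S\<close> by (intro closed_contains_Inf) auto
    then have t1_T: "0 \<le> t1" "t1 \<le> T" by (auto simp: S_def)
    have before: "p t \<in> box (vec m) (vec M)" if "0 \<le> t" "t < t1" for t
    proof (rule ccontr)
      assume "\<not> ?thesis"
      then have "t \<in> S" using that t1_T by (auto simp: S_def)
      then have "t1 \<le> t" unfolding t1_def using bdd by (rule cInf_lower)
      then show False using that by simp
    qed
    have "p 0 \<in> box (vec m) (vec M)" using p0_box init by (simp add: mem_box_cart)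
    then have "t1 > 0" using t1 t1_T by (cases "t1 = 0") (auto simp: S_def)
    have K: "p t \<in> ?K" if "t \<in> {0..t1}" for t
    proof -
      have "continuous_on (closure {0..<t1}) p"
        using cont \<open>t1 > 0\<close> t1_T by (auto intro: continuous_on_subset)
      moreover have "p ` {0..<t1} \<subseteq> ?K"
        using before box_subset_cbox[of "vec m" "vec M :: real^3"] by auto
      ultimately have "p ` closure {0..<t1} \<subseteq> ?K"
        by (intro image_closure_subset) auto
      then show ?thesis using that \<open>t1 > 0\<close> by auto
    qed
    have sol: "ode_solution_on F D {0..t1} p"
      unfolding ode_solution_on_def
    proof (intro ballI conjI)
      fix t assume t: "t \<in> {0..t1}"
      then show "p t \<in> D" using K box_subset_positive_prices[OF m] by blast
      have "(p has_vector_derivative v t) (at t within {0..t1})"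
        using t t1_T by (intro has_vector_derivative_within_subset[OF deriv]) auto
      then show "(p has_vector_derivative F (p t)) (at t within {0..t1})"
        using v K[OF t] t t1_T by auto
    qed
    have p1_D: "p t1 \<in> D" and p1_K: "\<forall>j. m \<le> p t1 $ j"
      using sol K[of t1] \<open>t1 > 0\<close> by (auto simp: ode_solution_on_def mem_cbox_vec)
    have level: "price_level \<gamma> (p t1) = price_level \<gamma> p0"
      using price_level_constant[OF sol, of 0 t1] t1_T init by simp
    have comp: "((\<lambda>t. p t $ i) has_real_derivative F (p t1) $ i) (at t1 within {0..t1})" for i
      using bounded_linear.has_vector_derivative[OF bounded_linear_vec_nth, of p "F (p t1)"] sol t1_T
      by (simp add: has_real_derivative_iff_has_vector_derivative ode_solution_on_def)
    obtain i where "p t1 $ i \<le> m \<or> M \<le> p t1 $ i"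
      using t1 by (auto simp: S_def mem_box_cart not_less)
    moreover have "m \<le> p t1 $ i" "p t1 $ i \<le> M"
      using K[of t1] \<open>t1 > 0\<close> by (simp_all add: mem_cbox_vec)
    ultimately have "p t1 $ i = m \<or> p t1 $ i = M" by linarith
    then show False
    proof
      assume i: "p t1 $ i = m"
      obtain j where "R * m \<le> p t1 $ j" using low[OF p1_K level i] by blast
      then have "0 < excess_demand A (p t1) $ i" using E_pos[OF p1_D] i by metis
      then have "0 < F (p t1) $ i"
        using positive_pricesD[OF p1_D, of i] by (simp add: price_field_def)
      from has_real_derivative_pos_inc_left[OF comp this] obtain d where d: "d > 0"
        "\<And>h. \<lbrakk>0 < h; t1 - h \<in> {0..t1}; h < d\<rbrakk> \<Longrightarrow> p (t1 - h) $ i < p t1 $ i" by auto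
      have "p (t1 - min (d / 2) t1) $ i < m"
        using d(2)[of "min (d / 2) t1"] d(1) \<open>t1 > 0\<close> i by auto
      moreover have "m < p (t1 - min (d / 2) t1) $ i"
        using before[of "t1 - min (d / 2) t1"] d(1) \<open>t1 > 0\<close> by (auto simp: mem_box_cart)
      ultimately show False by simp
    next
      assume i: "p t1 $ i = M"
      have "excess_demand A (p t1) $ i < 0"
        using high[OF p1_K level i] i by (intro E_neg[OF p1_D]) auto
      then have "F (p t1) $ i < 0"
        using positive_pricesD[OF p1_D, of i] by (simp add: price_field_def mult_pos_neg)
      from has_real_derivative_neg_dec_left[OF comp this] obtain d where d: "d > 0"
        "\<And>h. \<lbrakk>0 < h; t1 - h \<in> {0..t1}; h < d\<rbrakk> \<Longrightarrow> p t1 $ i < p (t1 - h) $ i" by auto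
      have "M < p (t1 - min (d / 2) t1) $ i"
        using d(2)[of "min (d / 2) t1"] d(1) \<open>t1 > 0\<close> i by auto
      moreover have "p (t1 - min (d / 2) t1) $ i < M"
        using before[of "t1 - min (d / 2) t1"] d(1) \<open>t1 > 0\<close> by (auto simp: mem_box_cart)
      ultimately show False by simp
    qed
  qed
  show ?thesis
  proof (rule that[of m M])
    show "p0 \<in> ?K" using p0_box by (auto simp: mem_cbox_vec less_imp_le)
    show "traps F ?K p0" unfolding traps_def using stay by metis
  qed (fact m)
qed

text \<open>
  Composing the field with the projection onto a trapping box makes it bounded and Lipschitz
  without changing it on the box. The global solution of the modified equation is trapped, so it
  solves the original one. Every other solution from the same point is trapped as well, and
  the Lipschitz bound on the box forces the two to agree.
\<close>

lemma unique_global_solution: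
  assumes p0: "p0 \<in> D"
  shows "\<exists>p. ode_solution_on F D {0..} p \<and> p 0 = p0 \<and>
    (\<forall>T q. ode_solution_on F D {0..<T} q \<and> q 0 = p0 \<longrightarrow> (\<forall>t\<in>{0..<T}. q t = p t))"
proof -
  obtain m M where m: "0 < m" "p0 \<in> cbox (vec m) (vec M)"
    and traps: "traps F (cbox (vec m) (vec M)) p0"
    using trapping_region[OF p0] by blast
  let ?K = "cbox (vec m) (vec M) :: (real^3) set"
  obtain N where N: "N-lipschitz_on ?K F"
    using price_field_lipschitz_on_box[OF m(1)] by blast
  define G where "G x = F (clamp (vec m) (vec M) x)" for x
  have clamp: "clamp (vec m) (vec M) x \<in> ?K" for x
    using m(2) by (intro clamp_in_interval) (auto simp: mem_box intro: order_trans)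
  have G_K: "G x = F x" if "x \<in> ?K" for x
    using that by (simp add: G_def clamp_cancel_cbox)
  have "N-lipschitz_on UNIV G"
  proof (rule lipschitz_onI)
    fix x y
    have "dist (G x) (G y) \<le> N * dist (clamp (vec m) (vec M) x) (clamp (vec m) (vec M) y)"
      unfolding G_def using N clamp clamp by (rule lipschitz_onD)
    also have "\<dots> \<le> N * dist x y"
      using lipschitz_on_nonneg[OF N] by (intro mult_left_mono dist_clamps_le_dist_args)
    finally show "dist (G x) (G y) \<le> N * dist x y" .
  qed (rule lipschitz_on_nonneg[OF N])
  moreover have "bounded (range G)"
  proof (rule bounded_subset)
    show "bounded (F ` ?K)"
      using lipschitz_on_continuous_on[OF N]
      by (intro compact_imp_bounded compact_continuous_image) auto
    show "range G \<subseteq> F ` ?K" using clamp by (auto simp: G_def)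
  qed
  ultimately obtain p where p: "p 0 = p0" "ode_solution_on G UNIV {0..} p"
    by (rule global_solution_of_bounded_lipschitz_field)
  have p_K: "p t \<in> ?K" if "0 \<le> t" for t
    by (rule trapsD[OF traps p G_K that]) auto
  have sol: "ode_solution_on F ?K {0..} p"
    using p(2) p_K G_K by (auto simp: ode_solution_on_def)
  have "q t = p t" if q: "ode_solution_on F D {0..<T} q" "q 0 = p0" and t: "t \<in> {0..<T}" for T q t
  proof (rule solutions_agree_if_lipschitz[OF N _ _ _ t])
    show "p 0 = q 0" using p q by simp
    have "q r \<in> ?K" if "r \<in> {0..<T}" for r
      by (rule trapsD[OF traps q(2,1)]) (use that in auto)
    then show "ode_solution_on F ?K {0..<T} q"
      using q(1) by (auto simp: ode_solution_on_def)
    show "ode_solution_on F ?K {0..<T} p"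
      using sol by (rule ode_solution_on_subset) auto
  qed
  moreover have "ode_solution_on F D {0..} p"
    using sol box_subset_positive_prices[OF m(1)] by (auto simp: ode_solution_on_def)
  ultimately show ?thesis using p(1) by blast
qed

end

section \<open>Stability and convergence\<close>

context stable_endowments
begin

text \<open>
  The derivative of each summand of the potential is \<open>x powr (- \<gamma> - 1) * (x\<^sup>2 / s\<^sup>2 - 1)\<close>, which
  changes sign exactly at \<open>s\<close>.
\<close>

lemma potential_summand_minimum:
  assumes s: "0 < s" and e: "0 < e"
  defines "\<phi> \<equiv> \<lambda>x. power_primitive (2 - \<gamma>) x / s\<^sup>2 - power_primitive (- \<gamma>) x"
  obtains \<eta> where "0 < \<eta>" and "\<And>x. 0 < x \<Longrightarrow> \<phi> s \<le> \<phi> x"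
    and "\<And>x. \<lbrakk>0 < x; e \<le> \<bar>x - s\<bar>\<rbrakk> \<Longrightarrow> \<phi> s + \<eta> \<le> \<phi> x"
proof -
  define \<phi>' where "\<phi>' x = x powr (- \<gamma> - 1) * (x\<^sup>2 / s\<^sup>2 - 1)" for x :: real
  have deriv: "(\<phi> has_real_derivative \<phi>' x) (at x)" if "0 < x" for x
  proof -
    have "(\<phi> has_real_derivative x powr (2 - \<gamma> - 1) / s\<^sup>2 - x powr (- \<gamma> - 1)) (at x)"
      unfolding \<phi>_def using that
      by (intro DERIV_diff DERIV_cdivide has_real_derivative_power_primitive)
    moreover have "x powr (2 - \<gamma> - 1) = x powr (- \<gamma> - 1) * x\<^sup>2"
      using that powr_add[of x "- \<gamma> - 1" 2] by (simp add: powr_numeral)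
    ultimately show ?thesis by (simp add: \<phi>'_def algebra_simps)
  qed
  have incr: "\<phi> x < \<phi> y" if "s \<le> x" "x < y" for x y
  proof (rule DERIV_pos_imp_increasing_open[OF \<open>x < y\<close>])
    fix t assume t: "x < t" "t < y"
    then have "s\<^sup>2 < t\<^sup>2" using s that by (intro power_strict_mono) auto
    then have "0 < \<phi>' t" using s t that by (simp add: \<phi>'_def)
    then show "\<exists>l. DERIV \<phi> t :> l \<and> 0 < l" using deriv[of t] s t that by auto
  next
    show "continuous_on {x..y} \<phi>"
      using deriv[THEN DERIV_isCont] s that by (intro continuous_at_imp_continuous_on) auto
  qed
  have decr: "\<phi> y < \<phi> x" if "0 < x" "x < y" "y \<le> s" for x y
  proof (rule DERIV_neg_imp_decreasing_open[OF \<open>x < y\<close>])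
    fix t assume t: "x < t" "t < y"
    then have "t\<^sup>2 < s\<^sup>2" using s that by (intro power_strict_mono) auto
    then have "\<phi>' t < 0" using s t that by (simp add: \<phi>'_def mult_pos_neg)
    then show "\<exists>l. DERIV \<phi> t :> l \<and> l < 0" using deriv[of t] s t that by auto
  next
    show "continuous_on {x..y} \<phi>"
      using deriv[THEN DERIV_isCont] s that by (intro continuous_at_imp_continuous_on) auto
  qed
  define r where "r = min e (s / 2)"
  have r: "0 < r" "r < s" "r \<le> e" using s e by (auto simp: r_def)
  define \<eta> where "\<eta> = min (\<phi> (s - r) - \<phi> s) (\<phi> (s + r) - \<phi> s)"
  show ?thesis
  proof
    show "0 < \<eta>" using decr[of "s - r" s] incr[of s "s + r"] r by (simp add: \<eta>_def)
    show "\<phi> s \<le> \<phi> x" if "0 < x" for x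
      using decr[of x s] incr[of s x] that by (cases x s rule: linorder_cases) auto
    show "\<phi> s + \<eta> \<le> \<phi> x" if x: "0 < x" "e \<le> \<bar>x - s\<bar>" for x
    proof (cases "x \<le> s")
      case True
      then have "x \<le> s - r" using x r by auto
      then have "\<phi> (s - r) \<le> \<phi> x" using decr[of x "s - r"] x r by (cases "x = s - r") auto
      then show ?thesis by (simp add: \<eta>_def)
    next
      case False
      then have "s + r \<le> x" using x r by auto
      then have "\<phi> (s + r) \<le> \<phi> x" using incr[of "s + r" x] r by (cases "x = s + r") auto
      then show ?thesis by (simp add: \<eta>_def)
    qed
  qed
qed

lemma continuous_on_potential: "continuous_on D (potential s)"
proof -
  have "continuous_on D (\<lambda>p. power_primitive a (p $ i))" for a i
  proof (rule continuous_on_compose2[where g = "power_primitive a" and f = "\<lambda>p. p $ i" and t = "{0<..}"])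
    show "continuous_on {0<..} (power_primitive a)"
      using continuous_power_primitive by (auto simp: continuous_on_eq_continuous_within)
  qed (auto intro!: continuous_intros simp: positive_pricesD)
  then show ?thesis
    unfolding potential_def[abs_def] divide_inverse by (intro continuous_intros)
qed

text \<open>
  Stability is stated from an arbitrary time \<open>r\<close> on, which is the form used to pass from an
  accumulation point of a trajectory to its limit.
\<close>

lemma equilibrium_stability:
  assumes e: "e \<in> D" "F e = 0" and \<epsilon>: "0 < \<epsilon>"
  obtains \<delta> where "0 < \<delta>"
    and "\<And>p r t. \<lbrakk>ode_solution_on F D {0..} p; 0 \<le> r; r \<le> t; dist (p r) e < \<delta>\<rbrakk> \<Longrightarrow> dist (p t) e < \<epsilon>"
proof -
  obtain s where s: "0 < s" "e = s *\<^sub>R p_star"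
    using e equilibrium_iff by blast
  have e_comp: "e $ i = s" for i
    using exhaust_3[of i] s by (auto simp: p_star_def)
  define \<phi> where "\<phi> x = power_primitive (2 - \<gamma>) x / s\<^sup>2 - power_primitive (- \<gamma>) x" for x
  have pot: "potential s x = (\<Sum>i\<in>UNIV. \<phi> (x $ i))" for x
    by (simp add: potential_def \<phi>_def)
  obtain \<eta> where \<eta>: "0 < \<eta>" and min: "\<And>x. 0 < x \<Longrightarrow> \<phi> s \<le> \<phi> x"
    and far: "\<And>x. \<lbrakk>0 < x; \<epsilon> / 4 \<le> \<bar>x - s\<bar>\<rbrakk> \<Longrightarrow> \<phi> s + \<eta> \<le> \<phi> x"
    using potential_summand_minimum[OF s(1), of "\<epsilon> / 4"] \<epsilon> unfolding \<phi>_def by auto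
  obtain \<delta> where \<delta>: "0 < \<delta>"
    "\<And>x. \<lbrakk>x \<in> D; dist x e < \<delta>\<rbrakk> \<Longrightarrow> dist (potential s x) (potential s e) < \<eta>"
    using continuous_on_potential[of s] e(1) \<eta> unfolding continuous_on_iff by metis
  have "dist (p t) e < \<epsilon>"
    if sol: "ode_solution_on F D {0..} p" and rt: "0 \<le> r" "r \<le> t" and near: "dist (p r) e < \<delta>" for p r t
  proof -
    have D: "p r \<in> D" "p t \<in> D" using sol rt by (auto simp: ode_solution_on_def)
    have "potential s (p t) \<le> potential s (p r)"
      using rt by (intro potential_nonincreasing[OF sol]) auto
    also have "\<dots> < potential s e + \<eta>"
      using \<delta>(2)[OF D(1) near] by (simp add: dist_real_def)
    finally have small: "potential s (p t) < potential s e + \<eta>" .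
    have close: "\<bar>p t $ i - s\<bar> < \<epsilon> / 4" for i
    proof (rule ccontr)
      assume "\<not> ?thesis"
      then have "\<phi> s + \<eta> \<le> \<phi> (p t $ i)"
        using far positive_pricesD[OF D(2)] by (simp add: not_less)
      moreover have "(\<Sum>j\<in>UNIV - {i}. \<phi> s) \<le> (\<Sum>j\<in>UNIV - {i}. \<phi> (p t $ j))"
        by (rule sum_mono) (rule min, rule positive_pricesD[OF D(2)])
      ultimately have "potential s e + \<eta> \<le> potential s (p t)"
        unfolding pot e_comp by (simp add: sum.remove[of UNIV i])
      then show False using small by simp
    qed
    have "dist (p t) e \<le> (\<Sum>i\<in>UNIV. \<bar>p t $ i - s\<bar>)"
      using norm_le_l1_cart[of "p t - e"] by (simp add: dist_norm e_comp)
    also have "\<dots> < \<epsilon>" using close[of 1] close[of 2] close[of 3] \<epsilon> by (simp add: sum_3)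
    finally show ?thesis .
  qed
  then show ?thesis using that \<delta>(1) by blast
qed

text \<open>
  Otherwise the potential would decrease at a rate bounded away from 0 and leave every bounded set.
\<close>

lemma dispersion_frequently_small:
  assumes sol: "ode_solution_on F D {0..} p" and K: "compact S" "S \<subseteq> D" "\<And>t. 0 \<le> t \<Longrightarrow> p t \<in> S"
    and "0 \<le> T" and "0 < \<eta>"
  obtains t where "T \<le> t" and "dispersion (p t) < \<eta>"
proof (rule ccontr)
  assume "\<not> thesis"
  then have large: "\<forall>t\<ge>T. \<eta> \<le> dispersion (p t)"
    using that by (meson not_less)
  have "continuous_on S (\<lambda>x. x $ 1 * x $ 2 * x $ 3)"
    by (intro continuous_intros)
  then have "bounded ((\<lambda>x. x $ 1 * x $ 2 * x $ 3) ` S)"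
    using K by (intro compact_imp_bounded compact_continuous_image)
  then obtain C where C: "0 < C" "\<And>x. x \<in> S \<Longrightarrow> \<bar>x $ 1 * x $ 2 * x $ 3\<bar> \<le> C"
    by (auto simp: bounded_pos)
  have "bounded (potential 1 ` S)"
    using K by (intro compact_imp_bounded compact_continuous_image continuous_on_subset[OF continuous_on_potential])
  then obtain B where B: "0 < B" "\<And>x. x \<in> S \<Longrightarrow> \<bar>potential 1 x\<bar> \<le> B"
    by (auto simp: bounded_pos)
  have decay: "potential 1 (p t) + \<eta> / C * t \<le> potential 1 (p T) + \<eta> / C * T" if "T \<le> t" for t
  proof (rule nonincreasing_on_interval[where f = "\<lambda>t. potential 1 (p t) + \<eta> / C * t" and I = "{0..}"])
    fix q assume q: "q \<in> {T..t}"
    then have p: "(p has_vector_derivative F (p q)) (at q within {0..})" "p q \<in> D"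
      using sol \<open>0 \<le> T\<close> by (auto simp: ode_solution_on_def)
    show "((\<lambda>t. potential 1 (p t) + \<eta> / C * t) has_real_derivative
      - (dispersion (p q) / (p q $ 1 * p q $ 2 * p q $ 3)) + \<eta> / C) (at q within {0..})"
      by (rule DERIV_add[OF potential_derivative[OF p] DERIV_cmult_Id])
    have "0 < p q $ 1 * p q $ 2 * p q $ 3"
      using positive_pricesD[OF p(2)] by simp
    moreover have "p q $ 1 * p q $ 2 * p q $ 3 \<le> C"
      using C(2)[of "p q"] K(3)[of q] q \<open>0 \<le> T\<close> by auto
    ultimately have "\<eta> / C \<le> dispersion (p q) / (p q $ 1 * p q $ 2 * p q $ 3)"
      using large q \<open>0 < \<eta>\<close> by (intro frac_le) auto
    then show "- (dispersion (p q) / (p q $ 1 * p q $ 2 * p q $ 3)) + \<eta> / C \<le> 0" by simp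
  qed (use that \<open>0 \<le> T\<close> in auto)
  \<comment> \<open>by this time the potential would have dropped by more than \<open>2 * B\<close>\<close>
  define t where "t = T + (2 * B + 1) * C / \<eta>"
  have t: "T \<le> t" using B C \<open>0 < \<eta>\<close> by (simp add: t_def)
  have "\<eta> / C * t = \<eta> / C * T + 2 * B + 1"
    using C \<open>0 < \<eta>\<close> by (simp add: t_def field_simps)
  then have "potential 1 (p t) + 2 * B + 1 \<le> potential 1 (p T)"
    using decay[OF t] by simp
  moreover have "\<bar>potential 1 (p t)\<bar> \<le> B" "\<bar>potential 1 (p T)\<bar> \<le> B"
    using B K(3) t \<open>0 \<le> T\<close> by auto
  ultimately show False by linarith
qed

text \<open>
  Along times at which the dispersion tends to 0 the trapped trajectory accumulates at a point of
  dispersion 0, that is, at an equilibrium. As the equilibrium is stable, the trajectory stays close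
  to it after having come close once.
\<close>

lemma converges_to_equilibrium:
  assumes sol: "ode_solution_on F D {0..} p"
  obtains c where "0 < c" and "(p \<longlongrightarrow> c *\<^sub>R p_star) at_top"
proof -
  have "p 0 \<in> D" using sol by (simp add: ode_solution_on_def)
  then obtain m M where m: "0 < m" and traps: "traps F (cbox (vec m) (vec M)) (p 0)"
    by (rule trapping_region)
  let ?K = "cbox (vec m) (vec M) :: (real^3) set"
  have K: "compact ?K" "?K \<subseteq> D" "\<And>t. 0 \<le> t \<Longrightarrow> p t \<in> ?K"
    using box_subset_positive_prices[OF m] by (auto intro: trapsD[OF traps refl sol])
  have "\<exists>t. real n \<le> t \<and> dispersion (p t) < inverse (real (Suc n))" for n
    by (rule dispersion_frequently_small[OF sol K, of "real n" "inverse (real (Suc n))"]) auto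
  then obtain \<tau> where \<tau>: "\<And>n. real n \<le> \<tau> n" "\<And>n. dispersion (p (\<tau> n)) < inverse (real (Suc n))"
    by metis
  have \<tau>_nonneg: "0 \<le> \<tau> n" for n
    using \<tau>(1)[of n] by linarith
  obtain e r where e: "e \<in> ?K" "strict_mono r" "((\<lambda>n. p (\<tau> n)) \<circ> r) \<longlonglongrightarrow> e"
    using K \<tau>_nonneg by (metis compact_def)
  have "(\<lambda>n. dispersion (p (\<tau> (r n)))) \<longlonglongrightarrow> dispersion e"
    using e(3) unfolding dispersion_def o_def by (intro tendsto_intros)
  moreover have "(\<lambda>n. dispersion (p (\<tau> (r n)))) \<longlonglongrightarrow> 0"
  proof (rule tendsto_sandwich[OF _ _ tendsto_const])
    show "(\<lambda>n. inverse (real (Suc (r n)))) \<longlonglongrightarrow> 0"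
      using LIMSEQ_subseq_LIMSEQ[OF LIMSEQ_inverse_real_of_nat e(2)] by (simp add: o_def)
  qed (use \<tau>(2) dispersion_nonneg in \<open>auto intro!: always_eventually less_imp_le\<close>)
  ultimately have "dispersion e = 0"
    by (rule LIMSEQ_unique)
  then have e_eq: "e = e $ 3 *\<^sub>R p_star" by (rule dispersion_eq_0D)
  have "e \<in> D" using e(1) K by blast
  then have e3: "0 < e $ 3" by (rule positive_pricesD)
  then have "F e = 0" using equilibrium_iff[OF \<open>e \<in> D\<close>] e_eq by blast
  have "(p \<longlongrightarrow> e) at_top"
  proof (rule tendstoI)
    fix \<epsilon> :: real assume "0 < \<epsilon>"
    obtain \<delta> where \<delta>: "0 < \<delta>" and
      stable: "\<And>p r t. \<lbrakk>ode_solution_on F D {0..} p; 0 \<le> r; r \<le> t; dist (p r) e < \<delta>\<rbrakk> \<Longrightarrow> dist (p t) e < \<epsilon>"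
      using equilibrium_stability[OF \<open>e \<in> D\<close> \<open>F e = 0\<close> \<open>0 < \<epsilon>\<close>] by blast
    obtain n where "dist (p (\<tau> (r n))) e < \<delta>"
      using tendstoD[OF e(3) \<delta>] by (auto simp: eventually_sequentially)
    then have "dist (p t) e < \<epsilon>" if "\<tau> (r n) \<le> t" for t
      using stable[OF sol \<tau>_nonneg that] by blast
    then show "\<forall>\<^sub>F t in at_top. dist (p t) e < \<epsilon>"
      by (auto simp: eventually_at_top_linorder)
  qed
  then show ?thesis using that[OF e3] e_eq by simp
qed

lemma limit_determined_by_price_level:
  assumes sol: "ode_solution_on F D {0..} p" and c: "0 < c" "(p \<longlongrightarrow> c *\<^sub>R p_star) at_top"
    and level: "price_level \<gamma> (p 0) = price_level \<gamma> p_star"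
  shows "c = 1"
proof -
  have comp: "p_star $ i = 1" for i
    using exhaust_3[of i] by (auto simp: p_star_def)
  have "((\<lambda>t. price_level \<gamma> (p t)) \<longlongrightarrow> price_level \<gamma> (c *\<^sub>R p_star)) at_top"
    unfolding price_level_eq_sum_power_primitive
  proof (rule tendsto_sum)
    fix i
    have "((\<lambda>t. p t $ i) \<longlongrightarrow> (c *\<^sub>R p_star) $ i) at_top"
      using c(2) by (rule tendsto_vec_nth)
    then show "((\<lambda>t. power_primitive (2 - \<gamma>) (p t $ i)) \<longlongrightarrow> power_primitive (2 - \<gamma>) ((c *\<^sub>R p_star) $ i)) at_top"
      by (rule isCont_tendsto_compose[rotated]) (use c comp in \<open>auto intro: continuous_power_primitive\<close>)
  qed
  moreover have "\<forall>\<^sub>F t in at_top. price_level \<gamma> (p t) = price_level \<gamma> p_star"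
    using eventually_ge_at_top[of 0]
    by eventually_elim (use price_level_constant[OF sol, of 0] level in auto)
  then have "((\<lambda>t. price_level \<gamma> (p t)) \<longlongrightarrow> price_level \<gamma> p_star) at_top"
    by (rule tendsto_eventually)
  ultimately have "price_level \<gamma> (c *\<^sub>R p_star) = price_level \<gamma> p_star"
    using tendsto_unique[OF trivial_limit_at_top_linorder] by blast
  then have "power_primitive (2 - \<gamma>) c = power_primitive (2 - \<gamma>) 1"
    by (simp add: price_level_eq_sum_power_primitive sum_3 comp)
  then show "c = 1"
    using power_primitive_less_iff[of c 1 "2 - \<gamma>"] power_primitive_less_iff[of 1 c "2 - \<gamma>"] c(1) by auto
qed

end

theorem theorem2:
  fixes A :: "real^3^3" and d1 d2 d3 K L \<gamma> :: real
  assumes "condition_A A"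
    and "A = endowment_matrix d1 d2 d3 K L"
    and "d1 \<ge> 0" and "d2 \<ge> 0" and "d3 \<ge> 0"
    and "d1 + d2 + d3 + K + L = 1"
    and "4 * (d1 * d2 + d2 * d3 + d3 * d1) - (d1 + d2 + d3)\<^sup>2 > 0"
    and "\<gamma> \<ge> 0"
  shows "globally_stable_on (price_field \<gamma> A) positive_prices \<and>
    (\<forall>p. ode_solution_on (price_field \<gamma> A) positive_prices {0..} p \<longrightarrow>
      (\<exists>c>0. (p \<longlongrightarrow> c *\<^sub>R p_star) at_top) \<and>
      (price_level \<gamma> (p 0) = price_level \<gamma> p_star \<longrightarrow> (p \<longlongrightarrow> p_star) at_top))"
proof -
  interpret stable_endowments A d1 d2 d3 K L \<gamma>
    by unfold_locales (use assms in auto)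
  have limit: "\<exists>c>0. (p \<longlongrightarrow> c *\<^sub>R p_star) at_top" if "ode_solution_on F D {0..} p" for p
    using converges_to_equilibrium[OF that] by blast
  have "globally_stable_on F D"
    unfolding globally_stable_on_def
  proof (intro conjI ballI impI allI)
    show "\<exists>p. ode_solution_on F D {0..} p \<and> p 0 = p0 \<and>
        (\<forall>T q. ode_solution_on F D {0..<T} q \<and> q 0 = p0 \<longrightarrow> (\<forall>t\<in>{0..<T}. q t = p t))"
      if "p0 \<in> D" for p0
      using that by (rule unique_global_solution)
    show "lyapunov_stable_on F D e" if "e \<in> D" "F e = 0" for e
      unfolding lyapunov_stable_on_def using equilibrium_stability[OF that] by (metis order_refl)
    show "\<exists>e\<in>D. F e = 0 \<and> (p \<longlongrightarrow> e) at_top" if sol: "ode_solution_on F D {0..} p" for p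
    proof -
      obtain c where c: "0 < c" "(p \<longlongrightarrow> c *\<^sub>R p_star) at_top"
        using limit[OF sol] by blast
      have D: "c *\<^sub>R p_star \<in> D"
        using c(1) by (simp add: positive_prices_def forall_3 p_star_def)
      moreover have "F (c *\<^sub>R p_star) = 0"
        using equilibrium_iff[OF D] c(1) by blast
      ultimately show ?thesis using c(2) by blast
    qed
  qed
  moreover have "(p \<longlongrightarrow> p_star) at_top"
    if sol: "ode_solution_on F D {0..} p" and level: "price_level \<gamma> (p 0) = price_level \<gamma> p_star" for p
    using limit[OF sol] limit_determined_by_price_level[OF sol _ _ level] by fastforce
  ultimately show ?thesis using limit by blast
qed

end
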